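(* Each of the following lattice polytopes admits a regular, unimodular and balanced triangulation: (a) the order polytope of any finite poset; (b) the hypersimplex $\Delta_{d,k}$ for any integers $0\le k\le d$, $d\geq 1$; (c) the $d$-dimensional cross polytope for any $d\ge1$; (d) any alcoved polytope.
   Context: All triangulations have lattice points as vertices. For a lattice polytope $Q$ of dimension $m$, a triangulation is unimodular if each of its $m$-simplices has normalized volume $1$ with respect to the lattice of integer points in the affine span of $Q$. It is regular if there is a convex function on $Q$ which is affine on each simplex of the triangulation but not on the union of any two different maximal simplices. It is balanced if its vertices can be colored with $m+1$ colors so that the two endpoints of every edge have different colors. The order polytope of a finite poset $P$ is the set of $y\in[0,1]^P$ with $y_a\le y_b$ whenever $a\le b$ in $P$. The hypersimplex $\Delta_{d,k}$ is the convex hull of all vectors in $\mathbb R^d$ having $k$ coordinates equal to $1$ and $d-k$ equal to $0$. The cross polytope is $\{x\in\mathbb R^d: |x_1|+\cdots+|x_d|\le1\}$. An alcoved polytope is a $d$-dimensional lattice polytope in $\mathbb R^d$ each of whose facets lies on a hyperplane of the form $x_i-x_j=\ell$ with $0\le i<j\le d$ and $\ell\in\mathbb Z$, where by convention $x_0=0$. *)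

theory Defs
  imports "HOL-Analysis.Analysis"
begin

definition integer_points :: "(real ^ 'n) set" where
  "integer_points = {x. \<forall>i. x $ i \<in> \<int>}"

definition lattice_polytope :: "(real ^ 'n) set \<Rightarrow> bool" where
  "lattice_polytope Q \<longleftrightarrow> (\<exists>V. finite V \<and> V \<subseteq> integer_points \<and> Q = convex hull V)"

text \<open>A triangulation is given by all its simplices (the empty face included), as in
  \<^const>\<open>simplicial_complex\<close>.\<close>

definition complex_vertices :: "(real ^ 'n) set set \<Rightarrow> (real ^ 'n) set" where
  "complex_vertices T = {v. \<exists>S\<in>T. v extreme_point_of S}"

definition lattice_triangulation :: "(real ^ 'n) set set \<Rightarrow> (real ^ 'n) set \<Rightarrow> bool" where
  "lattice_triangulation T Q \<longleftrightarrow>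
     simplicial_complex T \<and> \<Union>T = Q \<and> complex_vertices T \<subseteq> integer_points"

definition maximal_simplices :: "(real ^ 'n) set set \<Rightarrow> (real ^ 'n) set set" where
  "maximal_simplices T = {S \<in> T. \<forall>S'\<in>T. S \<subseteq> S' \<longrightarrow> S' = S}"

text \<open>The lattices below are affine: the integer points of an affine subspace, which need not
  contain the origin. Hence a basis comes with a base point.\<close>

definition affine_lattice_basis ::
    "(real ^ 'n) set \<Rightarrow> real ^ 'n \<Rightarrow> (real ^ 'n) set \<Rightarrow> bool" where
  "affine_lattice_basis L p B \<longleftrightarrow>
     independent B \<and> L = {p + (\<Sum>b\<in>B. of_int (z b) *\<^sub>R b) | z. True}"

text \<open>Normalized volume is \<open>m!\<close> times the \<open>m\<close>-dimensional Lebesgue measure in coordinates with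
  respect to a lattice basis, where \<open>m\<close> is the rank. It does not depend on the basis, as two
  bases differ by an integer translation and an integer matrix of determinant \<open>1\<close> or \<open>-1\<close>.
  It is a relation since a set of points \<open>L\<close> need not have a basis.\<close>

definition has_normalized_volume ::
    "(real ^ 'n) set \<Rightarrow> (real ^ 'n) set \<Rightarrow> real \<Rightarrow> bool" where
  "has_normalized_volume L S v \<longleftrightarrow>
     (\<exists>p B. affine_lattice_basis L p B \<and>
        v = fact (card B) *
            measure (Pi\<^sub>M B (\<lambda>_. lborel))
              {c \<in> space (Pi\<^sub>M B (\<lambda>_. lborel)). p + (\<Sum>b\<in>B. c b *\<^sub>R b) \<in> S})"

definition unimodular_triangulation :: "(real ^ 'n) set set \<Rightarrow> (real ^ 'n) set \<Rightarrow> bool" where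
  "unimodular_triangulation T Q \<longleftrightarrow>
     (\<forall>S\<in>T. aff_dim Q simplex S \<longrightarrow>
        has_normalized_volume (integer_points \<inter> affine hull Q) S 1)"

definition affine_function_on :: "(real ^ 'n) set \<Rightarrow> (real ^ 'n \<Rightarrow> real) \<Rightarrow> bool" where
  "affine_function_on S f \<longleftrightarrow> (\<exists>a c. \<forall>x\<in>S. f x = a \<bullet> x + c)"

definition regular_triangulation :: "(real ^ 'n) set set \<Rightarrow> (real ^ 'n) set \<Rightarrow> bool" where
  "regular_triangulation T Q \<longleftrightarrow>
     (\<exists>f. convex_on Q f \<and>
        (\<forall>S\<in>T. affine_function_on S f) \<and>
        (\<forall>S\<in>maximal_simplices T. \<forall>S'\<in>maximal_simplices T.
           S \<noteq> S' \<longrightarrow> \<not> affine_function_on (S \<union> S') f))"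

definition balanced_triangulation :: "(real ^ 'n) set set \<Rightarrow> (real ^ 'n) set \<Rightarrow> bool" where
  "balanced_triangulation T Q \<longleftrightarrow>
     (\<exists>col :: real ^ 'n \<Rightarrow> nat.
        (\<forall>v\<in>complex_vertices T. int (col v) < aff_dim Q + 1) \<and>
        (\<forall>u v. u \<noteq> v \<and> closed_segment u v \<in> T \<longrightarrow> col u \<noteq> col v))"

definition has_regular_unimodular_balanced_triangulation :: "(real ^ 'n) set \<Rightarrow> bool" where
  "has_regular_unimodular_balanced_triangulation Q \<longleftrightarrow>
     (\<exists>T. lattice_triangulation T Q \<and> regular_triangulation T Q \<and>
          unimodular_triangulation T Q \<and> balanced_triangulation T Q)"

text \<open>The poset has carrier \<open>P\<close>, a possibly empty or proper subset of the finite index type;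
  \<open>\<real>\<^sup>P\<close> is the coordinate subspace of vectors vanishing outside \<open>P\<close>.\<close>

definition order_polytope :: "'p::finite set \<Rightarrow> ('p \<times> 'p) set \<Rightarrow> (real ^ 'p) set" where
  "order_polytope P r =
     {y. (\<forall>a\<in>P. 0 \<le> y $ a \<and> y $ a \<le> 1) \<and> (\<forall>a. a \<notin> P \<longrightarrow> y $ a = 0) \<and>
         (\<forall>a\<in>P. \<forall>b\<in>P. (a, b) \<in> r \<longrightarrow> y $ a \<le> y $ b)}"

definition hypersimplex :: "nat \<Rightarrow> (real ^ 'd) set" where
  "hypersimplex k =
     convex hull {x. (\<forall>i. x $ i = 0 \<or> x $ i = 1) \<and> card {i. x $ i = 1} = k}"

definition cross_polytope :: "(real ^ 'd) set" where
  "cross_polytope = {x. (\<Sum>i\<in>UNIV. \<bar>x $ i\<bar>) \<le> 1}"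

text \<open>\<open>None\<close> is the index \<open>0\<close> of the convention \<open>x\<^sub>0 = 0\<close>. No order on indices is needed
  in \<open>alcoved_polytope\<close>, since exchanging \<open>i\<close> and \<open>j\<close> only changes the sign of \<open>l\<close>.\<close>

definition coord0 :: "real ^ 'd \<Rightarrow> 'd option \<Rightarrow> real" where
  "coord0 x i = (case i of None \<Rightarrow> 0 | Some j \<Rightarrow> x $ j)"

definition alcoved_polytope :: "(real ^ 'd) set \<Rightarrow> bool" where
  "alcoved_polytope Q \<longleftrightarrow>
     lattice_polytope Q \<and> aff_dim Q = int CARD('d) \<and>
     (\<forall>F. F facet_of Q \<longrightarrow>
        (\<exists>i j. i \<noteq> j \<and> (\<exists>l::int. F \<subseteq> {x. coord0 x i - coord0 x j = of_int l})))"

end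

theory Submission
  imports Defs
begin

text \<open>
  Fix a finite set \<open>\<Phi>\<close> of integral linear forms and a finite set \<open>V\<close> of lattice points. Call two
  points of \<open>V\<close> close if no form in \<open>\<Phi>\<close> separates them by more than \<open>1\<close>, and consider the convex
  hulls of all sets of pairwise close points. Two conditions make these hulls a triangulation of
  \<open>convex hull V\<close> with the wanted properties (locale \<open>close_points_triangulation\<close>).

  The first condition says that two points that are not close can be replaced by two close points
  with the same sum. Such a replacement decreases the sum of the squares of the forms. Hence, for a
  point of the hull, a convex combination of \<open>V\<close> that minimizes the weighted sum of these squares
  has pairwise close support, and the simplices cover (\<open>convex_hull_covered\<close>).
  The second condition says that each simplex has a vertex \<open>v\<close> and a form in \<open>\<Phi>\<close> that is constant
  on the remaining vertices and takes a neighbouring integer at \<open>v\<close>. Peeling off vertices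
  one by one shows that a lattice point in the affine hull of a simplex has integer barycentric
  coordinates (\<open>clique_coefficients_Ints\<close>), which gives affine independence and unimodularity.
  Simplices meet in common faces because every vertex that carries weight at a point \<open>x\<close> is at
  distance less than \<open>1\<close> from \<open>x\<close> under each form, so that the vertices carrying \<open>x\<close>
  in two simplices are again pairwise close (\<open>clique_hull_Int\<close>).

  Regularity holds without further conditions. The lifting function is the sum over \<open>\<Phi>\<close> of the
  piecewise linear interpolation of \<open>t\<^sup>2\<close> at the integers. If it were affine on the union of two
  different maximal simplices, the affine function would bound it from below on the whole polytope
  (\<open>affine_minorant_of_maximal_simplex\<close>), but at the midpoint of two vertices that are not close
  the lifting function lies strictly below the chord.

  For order polytopes, hypersimplices and alcoved polytopes, \<open>\<Phi>\<close> consists of the differences of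
  integral coordinates, one of which is \<open>0\<close>; the replacement rounds the midpoint of two lattice
  points down and up, and simplices are chains of points, coloured by their
  coordinate sum modulo the dimension plus one (\<open>alcove_triangulation\<close>). The coordinates are the
  standard ones, except for hypersimplices, where partial sums are used. For cross polytopes,
  \<open>\<Phi>\<close> consists of the coordinates themselves.
\<close>

section \<open>Simplices with the integer coefficient property\<close>

lemma inner_integer_points:
  assumes "x \<in> integer_points" "y \<in> integer_points"
  shows "x \<bullet> y \<in> \<int>"
  using assms unfolding integer_points_def inner_vec_def by (auto intro!: Ints_sum Ints_mult)

lemma integer_points_add: "x \<in> integer_points \<Longrightarrow> y \<in> integer_points \<Longrightarrow> x + y \<in> integer_points"
  by (auto simp: integer_points_def)

lemma integer_points_diff: "x \<in> integer_points \<Longrightarrow> y \<in> integer_points \<Longrightarrow> x - y \<in> integer_points"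
  by (auto simp: integer_points_def)

lemma integer_points_scale: "a \<in> \<int> \<Longrightarrow> x \<in> integer_points \<Longrightarrow> a *\<^sub>R x \<in> integer_points"
  by (auto simp: integer_points_def)

lemma integer_points_zero: "0 \<in> integer_points"
  by (auto simp: integer_points_def)

lemma integer_points_sum: "(\<And>i. i \<in> I \<Longrightarrow> f i \<in> integer_points) \<Longrightarrow> sum f I \<in> integer_points"
  by (induction I rule: infinite_finite_induct) (auto simp: integer_points_zero integer_points_add)

lemma affine_independent_coefficients_eq:
  fixes \<sigma> :: "(real ^ 'n) set"
  assumes "\<not> affine_dependent \<sigma>" "sum a \<sigma> = sum b \<sigma>"
    "(\<Sum>v\<in>\<sigma>. a v *\<^sub>R v) = (\<Sum>v\<in>\<sigma>. b v *\<^sub>R v)" "v \<in> \<sigma>"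
  shows "a v = b v"
proof (rule ccontr)
  assume "a v \<noteq> b v"
  then have "affine_dependent \<sigma>"
    using assms aff_independent_finite[OF assms(1)]
    by (subst affine_dependent_explicit_finite)
      (auto intro!: exI[of _ "\<lambda>v. a v - b v"] simp: sum_subtractf scaleR_left_diff_distrib)
  then show False using assms by simp
qed

text \<open>The edges at a vertex \<open>p\<close> form a lattice basis because the coefficients of a lattice point are
  integers. In the coordinates of this basis the simplex is the standard simplex, whose volume is
  the reciprocal of a factorial.\<close>
lemma unimodular_simplex_volume:
  fixes \<sigma> :: "(real ^ 'n) set"
  assumes indep: "\<not> affine_dependent \<sigma>" and ne: "\<sigma> \<noteq> {}" and int: "\<sigma> \<subseteq> integer_points"
    and coeff: "\<And>a. sum a \<sigma> = 1 \<Longrightarrow> (\<Sum>v\<in>\<sigma>. a v *\<^sub>R v) \<in> integer_points \<Longrightarrow> \<forall>v\<in>\<sigma>. a v \<in> \<int>"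
  shows "has_normalized_volume (integer_points \<inter> affine hull \<sigma>) (convex hull \<sigma>) 1"
proof -
  obtain p where p: "p \<in> \<sigma>" using ne by blast
  have fin: "finite \<sigma>" using indep by (rule aff_independent_finite)
  define B where "B = (\<lambda>v. - p + v) ` (\<sigma> - {p})"
  have B: "independent B"
    using indep p affine_dependent_iff_dependent2[OF p] by (simp add: B_def)
  have finB: "finite B" using fin by (simp add: B_def)
  have sumB: "(\<Sum>b\<in>B. f b) = (\<Sum>v\<in>\<sigma> - {p}. f (v - p))" for f :: "_ \<Rightarrow> 'b::comm_monoid_add"
    unfolding B_def by (subst sum.reindex) (auto simp: inj_on_def)
  define bary :: "(real ^ 'n \<Rightarrow> real) \<Rightarrow> real ^ 'n \<Rightarrow> real"
    where "bary c v = (if v = p then 1 - sum c B else c (v - p))" for c v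
  have bary1: "sum (bary c) \<sigma> = 1" for c
  proof -
    have "sum (bary c) \<sigma> = bary c p + sum (bary c) (\<sigma> - {p})"
      using fin p by (simp add: sum.remove)
    also have "sum (bary c) (\<sigma> - {p}) = sum c B"
      unfolding sumB by (rule sum.cong) (auto simp: bary_def)
    finally have "sum (bary c) \<sigma> = bary c p + sum c B" .
    then show ?thesis by (simp add: bary_def[of c p])
  qed
  have bary2: "(\<Sum>v\<in>\<sigma>. bary c v *\<^sub>R v) = p + (\<Sum>b\<in>B. c b *\<^sub>R b)" for c
  proof -
    have "(\<Sum>v\<in>\<sigma>. bary c v *\<^sub>R v) = bary c p *\<^sub>R p + (\<Sum>v\<in>\<sigma> - {p}. bary c v *\<^sub>R v)"
      using fin p by (simp add: sum.remove)
    also have "(\<Sum>v\<in>\<sigma> - {p}. bary c v *\<^sub>R v) = (\<Sum>v\<in>\<sigma> - {p}. c (v - p) *\<^sub>R (v - p) + c (v - p) *\<^sub>R p)"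
      by (rule sum.cong) (auto simp: bary_def algebra_simps)
    also have "\<dots> = (\<Sum>b\<in>B. c b *\<^sub>R b) + sum c B *\<^sub>R p"
      by (simp add: sum.distrib sumB scaleR_sum_left)
    finally show ?thesis by (simp add: bary_def algebra_simps)
  qed
  have lattice: "integer_points \<inter> affine hull \<sigma> = {p + (\<Sum>b\<in>B. of_int (z b) *\<^sub>R b) | z. True}"
  proof (intro equalityI subsetI)
    fix x assume x: "x \<in> integer_points \<inter> affine hull \<sigma>"
    then obtain a where a: "sum a \<sigma> = 1" "(\<Sum>v\<in>\<sigma>. a v *\<^sub>R v) = x"
      using fin by (auto simp: affine_hull_finite)
    have aint: "\<forall>v\<in>\<sigma>. a v \<in> \<int>" using coeff a x by blast
    define z where "z b = \<lfloor>a (p + b)\<rfloor>" for b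
    define c where "c b = real_of_int (z b)" for b
    have eq: "bary c v = a v" if "v \<in> \<sigma>" for v
    proof -
      have *: "c (v - p) = a v" if "v \<in> \<sigma>" for v
        using aint that by (simp add: c_def z_def)
      have "sum c B = sum a (\<sigma> - {p})"
        unfolding sumB by (rule sum.cong) (auto simp: *)
      then have "1 - sum c B = a p"
        using a(1) fin p by (simp add: sum.remove)
      then show ?thesis using * that by (simp add: bary_def)
    qed
    have "x = p + (\<Sum>b\<in>B. c b *\<^sub>R b)"
      unfolding bary2[symmetric] a(2)[symmetric] by (rule sum.cong) (auto simp: eq)
    then show "x \<in> {p + (\<Sum>b\<in>B. of_int (z b) *\<^sub>R b) | z. True}"
      unfolding c_def by blast
  next
    fix x assume "x \<in> {p + (\<Sum>b\<in>B. of_int (z b) *\<^sub>R b) | z. True}"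
    then obtain z where x: "x = p + (\<Sum>b\<in>B. real_of_int (z b) *\<^sub>R b)" by blast
    have "b \<in> integer_points" if "b \<in> B" for b
      using that p int by (auto simp: B_def intro!: integer_points_diff)
    then have "x \<in> integer_points"
      unfolding x using p int
      by (auto intro!: integer_points_add integer_points_sum integer_points_scale)
    moreover have "x \<in> affine hull \<sigma>"
      unfolding x bary2[symmetric] using fin bary1 by (auto simp: affine_hull_finite)
    ultimately show "x \<in> integer_points \<inter> affine hull \<sigma>" by blast
  qed
  have mem: "p + (\<Sum>b\<in>B. c b *\<^sub>R b) \<in> convex hull \<sigma> \<longleftrightarrow> (\<forall>b\<in>B. 0 \<le> c b) \<and> sum c B \<le> 1" for c
  proof
    assume "p + (\<Sum>b\<in>B. c b *\<^sub>R b) \<in> convex hull \<sigma>"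
    then obtain l where l: "\<forall>v\<in>\<sigma>. 0 \<le> l v" "sum l \<sigma> = 1" "(\<Sum>v\<in>\<sigma>. l v *\<^sub>R v) = (\<Sum>v\<in>\<sigma>. bary c v *\<^sub>R v)"
      using fin by (auto simp: convex_hull_finite bary2)
    have eq: "l v = bary c v" if "v \<in> \<sigma>" for v
      using affine_independent_coefficients_eq[OF indep _ l(3) that] l(2) bary1 by simp
    have "0 \<le> bary c v" if "v \<in> \<sigma>" for v
      using eq[OF that, symmetric] l(1) that by simp
    note nonneg = this
    have "0 \<le> c b" if "b \<in> B" for b
    proof -
      have "p + b \<in> \<sigma>" "b \<noteq> 0" using that by (auto simp: B_def)
      then show ?thesis using nonneg[of "p + b"] by (simp add: bary_def)
    qed
    moreover have "sum c B \<le> 1" using nonneg[OF p] by (simp add: bary_def)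
    ultimately show "(\<forall>b\<in>B. 0 \<le> c b) \<and> sum c B \<le> 1" by blast
  next
    assume c: "(\<forall>b\<in>B. 0 \<le> c b) \<and> sum c B \<le> 1"
    have "0 \<le> bary c v" if "v \<in> \<sigma>" for v
      using c that by (auto simp: bary_def B_def)
    then show "p + (\<Sum>b\<in>B. c b *\<^sub>R b) \<in> convex hull \<sigma>"
      using fin bary1 bary2[symmetric] by (auto simp: convex_hull_finite intro!: exI[of _ "bary c"])
  qed
  let ?M = "Pi\<^sub>M B (\<lambda>_. lborel) :: (_ \<Rightarrow> real) measure"
  have "emeasure ?M ({c. (\<forall>b\<in>B. 0 \<le> c b) \<and> sum c B \<le> 1} \<inter> space ?M) = ennreal (1 / fact (card B))"
    using emeasure_std_simplex_aux[OF finB, of 1] by simp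
  also have "{c. (\<forall>b\<in>B. 0 \<le> c b) \<and> sum c B \<le> 1} \<inter> space ?M =
      {c \<in> space ?M. p + (\<Sum>b\<in>B. c b *\<^sub>R b) \<in> convex hull \<sigma>}"
    by (auto simp: mem)
  finally have "measure ?M {c \<in> space ?M. p + (\<Sum>b\<in>B. c b *\<^sub>R b) \<in> convex hull \<sigma>} = 1 / fact (card B)"
    by (simp add: measure_def)
  then show ?thesis
    unfolding has_normalized_volume_def affine_lattice_basis_def
    using B lattice by (intro exI[of _ p] exI[of _ B]) auto
qed

section \<open>Interpolating the square function\<close>

text \<open>The piecewise linear function that agrees with \<open>t\<^sup>2\<close> at the integers.\<close>
definition interp_square :: "real \<Rightarrow> real" where
  "interp_square t = (2 * of_int \<lfloor>t\<rfloor> + 1) * t - of_int \<lfloor>t\<rfloor> * (of_int \<lfloor>t\<rfloor> + 1)"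

text \<open>The line through the points of the parabola over \<open>n\<close> and \<open>n + 1\<close> lies nowhere above the
  interpolation. Thus the interpolation is the maximum of these lines, which is why it is convex.\<close>
lemma interp_square_ge:
  "(2 * of_int n + 1) * t - of_int n * (of_int n + 1) \<le> interp_square t"
proof -
  define m where "m = \<lfloor>t\<rfloor>"
  have m: "of_int m \<le> t" "t < of_int m + 1" unfolding m_def by linarith+
  have "0 \<le> (of_int m - of_int n) * (2 * t - (of_int m + of_int n + 1))"
  proof (cases "m = n")
    case False
    then consider "m \<ge> n + 1" | "m + 1 \<le> n" by linarith
    then show ?thesis
    proof cases
      case 1
      then have "real_of_int m \<ge> of_int n + 1" by linarith
      then show ?thesis using m by (intro mult_nonneg_nonneg) auto
    next
      case 2
      then have "real_of_int m + 1 \<le> of_int n" by linarith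
      then show ?thesis using m by (intro mult_nonpos_nonpos) auto
    qed
  qed simp
  then show ?thesis unfolding interp_square_def m_def[symmetric] by (simp add: algebra_simps)
qed

lemma interp_square_eq:
  assumes "of_int n \<le> t" "t \<le> of_int n + 1"
  shows "interp_square t = (2 * of_int n + 1) * t - of_int n * (of_int n + 1)"
proof (cases "t = of_int n + 1")
  case True
  then have "\<lfloor>t\<rfloor> = n + 1" by simp
  then show ?thesis using True by (simp add: interp_square_def algebra_simps)
next
  case False
  then have "\<lfloor>t\<rfloor> = n" using assms by linarith
  then show ?thesis by (simp add: interp_square_def)
qed

lemma interp_square_of_int: "interp_square (of_int n) = (of_int n)\<^sup>2"
  using interp_square_eq[of n "of_int n"] by (simp add: power2_eq_square algebra_simps)

lemma convex_on_interp_square: "convex_on UNIV interp_square"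
proof (intro convex_onI)
  fix s a b :: real assume s: "0 < s" "s < 1"
  define t where "t = (1 - s) *\<^sub>R a + s *\<^sub>R b"
  define A B where "A = 2 * real_of_int \<lfloor>t\<rfloor> + 1" and "B = real_of_int \<lfloor>t\<rfloor> * (of_int \<lfloor>t\<rfloor> + 1)"
  have "interp_square t = (1 - s) * (A * a - B) + s * (A * b - B)"
    unfolding interp_square_def A_def[symmetric] B_def[symmetric]
    by (simp add: t_def algebra_simps)
  also have "\<dots> \<le> (1 - s) * interp_square a + s * interp_square b"
    using s interp_square_ge[of "\<lfloor>t\<rfloor>"] by (intro add_mono mult_left_mono) (auto simp: A_def B_def)
  finally show "interp_square ((1 - s) *\<^sub>R a + s *\<^sub>R b) \<le> (1 - s) * interp_square a + s * interp_square b"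
    by (simp add: t_def)
qed auto

text \<open>The interpolation exceeds \<open>t\<^sup>2\<close> by at most \<open>1/4\<close>, whereas the chord of the parabola between
  \<open>a\<close> and \<open>b\<close> lies \<open>(a - b)\<^sup>2 / 4\<close> above its midpoint.\<close>
lemma interp_square_midpoint_less:
  assumes "a \<in> \<int>" "b \<in> \<int>" "\<bar>a - b\<bar> > 1"
  shows "interp_square ((a + b) / 2) < (interp_square a + interp_square b) / 2"
proof -
  have "interp_square t \<le> t\<^sup>2 + 1/4" for t
  proof -
    have "0 \<le> (t - of_int \<lfloor>t\<rfloor> - 1/2)\<^sup>2" by simp
    then show ?thesis by (simp add: interp_square_def power2_eq_square algebra_simps)
  qed
  note le = this[of "(a + b) / 2"]
  have "1 < \<bar>a - b\<bar>\<^sup>2" using assms(3) by (intro one_less_power) auto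
  then have "1 < (a - b)\<^sup>2" by (simp only: power2_abs)
  then have "((a + b) / 2)\<^sup>2 + 1/4 < (a\<^sup>2 + b\<^sup>2) / 2"
    by (simp add: power2_eq_square field_simps)
  moreover have "interp_square a = a\<^sup>2" "interp_square b = b\<^sup>2"
    using assms(1,2) by (auto elim!: Ints_cases simp: interp_square_of_int)
  ultimately show ?thesis using le by simp
qed

section \<open>Maximal simplices of a complex with convex union\<close>

text \<open>Near \<open>x\<close> only simplices that contain \<open>x\<close> occur, and such a simplex contains \<open>S\<close>, because
  its intersection with \<open>S\<close> is a face of \<open>S\<close> through a relative interior point.\<close>
lemma maximal_simplex_absorbs_segment:
  fixes C :: "(real ^ 'n) set set"
  assumes "finite C" "\<And>S. S \<in> C \<Longrightarrow> closed S"
    and face: "\<And>S S'. S \<in> C \<Longrightarrow> S' \<in> C \<Longrightarrow> (S \<inter> S') face_of S"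
    and conv: "convex (\<Union>C)" and max: "S \<in> maximal_simplices C"
    and x: "x \<in> rel_interior S" and y: "y \<in> \<Union>C"
  obtains e where "0 < e" "e \<le> 1" "(1 - e) *\<^sub>R x + e *\<^sub>R y \<in> S"
proof -
  have S: "S \<in> C" using max by (simp add: maximal_simplices_def)
  have xS: "x \<in> S" using x rel_interior_subset by blast
  \<comment> \<open>The simplices that the segment must avoid at the start; their union is closed.\<close>
  define U where "U = \<Union>{S'\<in>C. x \<notin> S'}"
  have "closed U" unfolding U_def using assms(1,2) by (intro closed_Union) auto
  moreover have "x \<notin> U" by (auto simp: U_def)
  ultimately have "\<forall>\<^sub>F z in nhds x. z \<notin> U"
    using eventually_nhds_in_open[of "- U" x] by (simp add: open_Compl)
  moreover have "((\<lambda>e. (1 - e) *\<^sub>R x + e *\<^sub>R y) \<longlongrightarrow> (1 - 0) *\<^sub>R x + 0 *\<^sub>R y) (at_right 0)"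
    by (intro tendsto_intros)
  then have "((\<lambda>e. (1 - e) *\<^sub>R x + e *\<^sub>R y) \<longlongrightarrow> x) (at_right 0)" by simp
  ultimately have "\<forall>\<^sub>F e in at_right 0. (1 - e) *\<^sub>R x + e *\<^sub>R y \<notin> U"
    by (rule eventually_compose_filterlim)
  moreover have "\<forall>\<^sub>F e::real in at_right 0. 0 < e \<and> e < 1"
    unfolding eventually_at_right_field by (intro exI[of _ 1]) auto
  ultimately have "\<forall>\<^sub>F e in at_right 0. (1 - e) *\<^sub>R x + e *\<^sub>R y \<notin> U \<and> 0 < e \<and> e < 1"
    by (rule eventually_conj)
  then obtain e where e: "(1 - e) *\<^sub>R x + e *\<^sub>R y \<notin> U" "0 < e" "e < 1"
    using eventually_happens' trivial_limit_at_right_real by blast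
  have "(1 - e) *\<^sub>R x + e *\<^sub>R y \<in> \<Union>C"
    using convexD_alt[OF conv, of x y e] xS S y e by auto
  then obtain S' where S': "S' \<in> C" "(1 - e) *\<^sub>R x + e *\<^sub>R y \<in> S'" by blast
  then have "x \<in> S'" using e(1) by (auto simp: U_def)
  then have "S \<subseteq> S \<inter> S'"
    using subset_of_face_of[OF face[OF S S'(1)], of S] x xS by auto
  then have "S' = S" using max S' by (auto simp: maximal_simplices_def)
  then show ?thesis using that e S' by auto
qed

text \<open>A segment from a relative interior point of \<open>S\<close> to \<open>y\<close> starts inside \<open>S\<close>, where \<open>f\<close> is affine;
  convexity of \<open>f\<close> along the segment then bounds \<open>f y\<close>.\<close>
lemma affine_minorant_of_maximal_simplex:
  fixes C :: "(real ^ 'n) set set"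
  assumes "finite C" "\<And>S. S \<in> C \<Longrightarrow> closed S"
    and face: "\<And>S S'. S \<in> C \<Longrightarrow> S' \<in> C \<Longrightarrow> (S \<inter> S') face_of S"
    and f: "convex_on (\<Union>C) f" and max: "S \<in> maximal_simplices C" and "convex S" "S \<noteq> {}"
    and L: "\<And>x. x \<in> S \<Longrightarrow> f x = a \<bullet> x + c" and y: "y \<in> \<Union>C"
  shows "a \<bullet> y + c \<le> f y"
proof -
  obtain x where x: "x \<in> rel_interior S"
    using \<open>convex S\<close> \<open>S \<noteq> {}\<close> rel_interior_eq_empty by blast
  have xS: "x \<in> S" using x rel_interior_subset by blast
  then have xC: "x \<in> \<Union>C" using max by (auto simp: maximal_simplices_def)
  obtain e where e: "0 < e" "e \<le> 1" "(1 - e) *\<^sub>R x + e *\<^sub>R y \<in> S"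
    using maximal_simplex_absorbs_segment[OF assms(1,2) face _ max x y] f
    by (auto simp: convex_on_def)
  have "a \<bullet> ((1 - e) *\<^sub>R x + e *\<^sub>R y) + c = f ((1 - e) *\<^sub>R x + e *\<^sub>R y)"
    using L e by simp
  also have "\<dots> \<le> (1 - e) * f x + e * f y"
    using convex_onD[OF f, of e x y] e xC y by simp
  also have "f x = a \<bullet> x + c" using L xS by simp
  finally have "e * (a \<bullet> y + c) \<le> e * f y"
    by (simp add: inner_add_right algebra_simps)
  then show ?thesis using e by simp
qed


section \<open>The complex of pairwise close lattice points\<close>

text \<open>Compactness of this hull provides a convex combination with minimal weighted height among all
  those that represent a given point.\<close>
lemma convex_hull_graph_finite:
  fixes F :: "'a::real_vector \<Rightarrow> 'b::real_vector"
  assumes "finite V"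
  shows "convex hull ((\<lambda>v. (v, F v)) ` V) =
    {(\<Sum>v\<in>V. l v *\<^sub>R v, \<Sum>v\<in>V. l v *\<^sub>R F v) | l. (\<forall>v\<in>V. 0 \<le> l v) \<and> sum l V = 1}"
proof -
  let ?G = "\<lambda>v. (v, F v)"
  have inj: "inj_on ?G V" by (auto simp: inj_on_def)
  have pair: "(\<Sum>v\<in>V. l v *\<^sub>R ?G v) = (\<Sum>v\<in>V. l v *\<^sub>R v, \<Sum>v\<in>V. l v *\<^sub>R F v)" for l
    by (simp add: prod_eq_iff fst_sum snd_sum)
  show ?thesis
  proof (intro equalityI subsetI)
    fix z assume "z \<in> convex hull (?G ` V)"
    then obtain u where u: "\<forall>x\<in>?G ` V. 0 \<le> u x" "sum u (?G ` V) = 1" "(\<Sum>x\<in>?G ` V. u x *\<^sub>R x) = z"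
      using assms by (auto simp: convex_hull_finite)
    have "z = (\<Sum>v\<in>V. u (?G v) *\<^sub>R ?G v)" "sum (\<lambda>v. u (?G v)) V = 1"
      using u(2,3) by (simp_all add: sum.reindex[OF inj] o_def)
    then show "z \<in> {(\<Sum>v\<in>V. l v *\<^sub>R v, \<Sum>v\<in>V. l v *\<^sub>R F v) | l. (\<forall>v\<in>V. 0 \<le> l v) \<and> sum l V = 1}"
      using u(1) by (subst (asm) pair) (auto intro!: exI[of _ "\<lambda>v. u (?G v)"])
  next
    fix z assume "z \<in> {(\<Sum>v\<in>V. l v *\<^sub>R v, \<Sum>v\<in>V. l v *\<^sub>R F v) | l. (\<forall>v\<in>V. 0 \<le> l v) \<and> sum l V = 1}"
    then obtain l where l: "\<forall>v\<in>V. 0 \<le> l v" "sum l V = 1"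
        "z = (\<Sum>v\<in>V. l v *\<^sub>R v, \<Sum>v\<in>V. l v *\<^sub>R F v)"
      by blast
    show "z \<in> convex hull (?G ` V)"
      unfolding l(3) pair[symmetric] using assms l by (intro convex_sum) (auto intro: hull_inc)
  qed
qed

lemma convex_combination_in_hull_support:
  assumes "finite V" "\<And>v. v \<in> V \<Longrightarrow> 0 \<le> l v" "sum l V = 1"
  shows "(\<Sum>v\<in>V. l v *\<^sub>R v) \<in> convex hull {v\<in>V. 0 < l v}"
proof -
  define S where "S = {v\<in>V. 0 < l v}"
  have sub: "S \<subseteq> V" by (auto simp: S_def)
  have z: "\<forall>v\<in>V - S. l v = 0" using assms(2) by (force simp: S_def)
  have "sum l V = sum l S" by (rule sum.mono_neutral_right[OF assms(1) sub z])
  moreover have "(\<Sum>v\<in>V. l v *\<^sub>R v) = (\<Sum>v\<in>S. l v *\<^sub>R v)"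
    using z by (intro sum.mono_neutral_right[OF assms(1) sub]) simp
  moreover have "(\<Sum>v\<in>S. l v *\<^sub>R v) \<in> convex hull S" if "sum l S = 1"
    using that finite_subset[OF sub assms(1)] by (intro convex_sum) (auto simp: S_def intro: hull_inc)
  ultimately show ?thesis using assms(3) by (simp add: S_def)
qed

locale close_points =
  fixes \<Phi> V :: "(real ^ 'n) set"
  assumes fin\<Phi>: "finite \<Phi>" and finV: "finite V" and neV: "V \<noteq> {}"
    and int\<Phi>: "\<Phi> \<subseteq> integer_points" and intV: "V \<subseteq> integer_points"
begin

definition close :: "real ^ 'n \<Rightarrow> real ^ 'n \<Rightarrow> bool" where
  "close u v \<longleftrightarrow> (\<forall>\<phi>\<in>\<Phi>. \<bar>\<phi> \<bullet> u - \<phi> \<bullet> v\<bar> \<le> 1)"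

definition clique :: "(real ^ 'n) set \<Rightarrow> bool" where
  "clique \<sigma> \<longleftrightarrow> \<sigma> \<subseteq> V \<and> (\<forall>u\<in>\<sigma>. \<forall>v\<in>\<sigma>. close u v)"

definition complex :: "(real ^ 'n) set set" where
  "complex = (\<lambda>\<sigma>. convex hull \<sigma>) ` Collect clique"

lemma close_refl: "close u u"
  by (simp add: close_def)

lemma close_sym: "close u v \<longleftrightarrow> close v u"
  by (simp add: close_def abs_minus_commute)

lemma clique_subset: "clique \<sigma> \<Longrightarrow> \<tau> \<subseteq> \<sigma> \<Longrightarrow> clique \<tau>"
  unfolding clique_def by blast

lemma clique_finite: "clique \<sigma> \<Longrightarrow> finite \<sigma>"
  unfolding clique_def using finV finite_subset by blast

lemma inner_Ints: "\<phi> \<in> \<Phi> \<Longrightarrow> v \<in> V \<Longrightarrow> \<phi> \<bullet> v \<in> \<int>"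
  using inner_integer_points int\<Phi> intV by blast

end

text \<open>\<open>resolve\<close> makes the simplices cover the convex hull of \<open>V\<close>, and \<open>peel\<close> makes each of them
  unimodular.\<close>
locale close_points_triangulation = close_points \<Phi> V for \<Phi> V :: "(real ^ 'n) set" +
  assumes resolve: "\<And>u v. \<lbrakk>u \<in> V; v \<in> V; \<not> close u v\<rbrakk> \<Longrightarrow>
      \<exists>u'\<in>V. \<exists>v'\<in>V. u' + v' = u + v \<and> close u' v'"
    and peel: "\<And>\<sigma> u w. \<lbrakk>clique \<sigma>; u \<in> \<sigma>; w \<in> \<sigma>; u \<noteq> w\<rbrakk> \<Longrightarrow>
      \<exists>v\<in>\<sigma>. \<exists>\<phi>\<in>\<Phi>. \<exists>n. \<bar>\<phi> \<bullet> v - n\<bar> = 1 \<and> (\<forall>w\<in>\<sigma> - {v}. \<phi> \<bullet> w = n)"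
begin

text \<open>The form that singles out the vertex \<open>v\<close> takes an integer value at the combination, and
  this value determines the coefficient of \<open>v\<close> up to sign and integers; then \<open>v\<close> is removed.\<close>
lemma clique_coefficients_Ints:
  assumes "clique \<sigma>" "sum a \<sigma> \<in> \<int>" "(\<Sum>v\<in>\<sigma>. a v *\<^sub>R v) \<in> integer_points"
  shows "\<forall>v\<in>\<sigma>. a v \<in> \<int>"
  using clique_finite[OF assms(1)] assms
proof (induction \<sigma> rule: finite_psubset_induct)
  case (psubset \<sigma>)
  note clq = psubset.prems(1)
  show ?case
  proof (cases "\<exists>u\<in>\<sigma>. \<exists>w\<in>\<sigma>. u \<noteq> w")
    case False
    have "a v \<in> \<int>" if "v \<in> \<sigma>" for v
    proof -
      have "\<sigma> = {v}" using False that by blast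
      then show ?thesis using psubset.prems(2) by simp
    qed
    then show ?thesis by blast
  next
    case True
    then obtain v \<phi> n where v: "v \<in> \<sigma>" "\<phi> \<in> \<Phi>" "\<bar>\<phi> \<bullet> v - n\<bar> = 1" "\<forall>w\<in>\<sigma> - {v}. \<phi> \<bullet> w = n"
      using peel[OF clq] by blast
    have \<sigma>V: "\<sigma> \<subseteq> V" using clq by (simp add: clique_def)
    obtain w where w: "w \<in> \<sigma> - {v}" using True by blast
    have n: "n \<in> \<int>" using w v(2,4) inner_Ints \<sigma>V by force
    have "\<phi> \<bullet> (\<Sum>w\<in>\<sigma>. a w *\<^sub>R w) = (\<Sum>w\<in>\<sigma>. a w * (\<phi> \<bullet> w))"
      by (simp add: inner_sum_right)
    also have "\<dots> = a v * (\<phi> \<bullet> v) + (\<Sum>w\<in>\<sigma> - {v}. a w * n)"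
      using psubset.hyps v(1,4) by (simp add: sum.remove)
    also have "(\<Sum>w\<in>\<sigma> - {v}. a w * n) = (sum a \<sigma> - a v) * n"
      using psubset.hyps v(1) by (simp add: sum_distrib_right[symmetric] sum_diff1)
    finally have eq: "a v * (\<phi> \<bullet> v - n) = \<phi> \<bullet> (\<Sum>w\<in>\<sigma>. a w *\<^sub>R w) - sum a \<sigma> * n"
      by (simp add: algebra_simps)
    have "\<phi> \<bullet> (\<Sum>w\<in>\<sigma>. a w *\<^sub>R w) \<in> \<int>"
      using inner_integer_points psubset.prems(3) v(2) int\<Phi> by blast
    then have "a v * (\<phi> \<bullet> v - n) \<in> \<int>"
      unfolding eq using n psubset.prems(2) by auto
    moreover have "\<phi> \<bullet> v - n = 1 \<or> \<phi> \<bullet> v - n = -1" using v(3) by linarith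
    ultimately have av: "a v \<in> \<int>" by auto
    have "\<forall>w\<in>\<sigma> - {v}. a w \<in> \<int>"
    proof (rule psubset.IH)
      show "\<sigma> - {v} \<subset> \<sigma>" using v(1) by blast
      show "clique (\<sigma> - {v})" using clq clique_subset by blast
      show "sum a (\<sigma> - {v}) \<in> \<int>"
        using psubset.hyps v(1) av psubset.prems(2) by (simp add: sum_diff1)
      have "v \<in> integer_points" using v(1) \<sigma>V intV by blast
      then show "(\<Sum>v\<in>\<sigma> - {v}. a v *\<^sub>R v) \<in> integer_points"
        using psubset.hyps v(1) av psubset.prems(3)
        by (simp add: sum_diff1 integer_points_diff integer_points_scale)
    qed
    then show ?thesis using av by blast
  qed
qed

text \<open>A real multiple of an affine dependence is an affine dependence, but the coefficients of every
  affine dependence are integers.\<close>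
lemma clique_affine_independent:
  assumes "clique \<sigma>"
  shows "\<not> affine_dependent \<sigma>"
proof
  assume "affine_dependent \<sigma>"
  then obtain a v where a: "sum a \<sigma> = 0" "v \<in> \<sigma>" "a v \<noteq> 0" "(\<Sum>v\<in>\<sigma>. a v *\<^sub>R v) = 0"
    using clique_finite[OF assms] by (auto simp: affine_dependent_explicit_finite)
  \<comment> \<open>This multiple has coefficient \<open>1/2\<close> at \<open>v\<close>.\<close>
  define t where "t = 1 / (2 * a v)"
  have "sum (\<lambda>v. t * a v) \<sigma> = 0" "(\<Sum>v\<in>\<sigma>. (t * a v) *\<^sub>R v) = 0"
    using a by (simp_all add: sum_distrib_left[symmetric] scaleR_scaleR[symmetric]
        scaleR_sum_right[symmetric] del: scaleR_scaleR)
  then have "t * a v \<in> \<int>"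
    using clique_coefficients_Ints[OF assms, of "\<lambda>v. t * a v"] a(2) by (simp add: integer_points_zero)
  then have "(1/2::real) \<in> \<int>" using a(3) by (simp add: t_def)
  then obtain k where "(1/2::real) = of_int k" by (rule Ints_cases)
  then have "of_int (2 * k) = (1::real)" by simp
  then have "2 * k = 1" by (simp only: of_int_eq_1_iff)
  then show False by presburger
qed

text \<open>With the sum of two numbers fixed, the sum of their squares grows with their distance. Under
  each form the distance does not increase: both distances have the same parity, so a distance \<open>0\<close>
  stays \<open>0\<close>.\<close>
lemma resolve_decreases_squares:
  assumes "u \<in> V" "v \<in> V" "u' \<in> V" "v' \<in> V" "u' + v' = u + v" "close u' v'" "\<not> close u v"
  shows "(\<Sum>\<phi>\<in>\<Phi>. (\<phi> \<bullet> u')\<^sup>2) + (\<Sum>\<phi>\<in>\<Phi>. (\<phi> \<bullet> v')\<^sup>2) < (\<Sum>\<phi>\<in>\<Phi>. (\<phi> \<bullet> u)\<^sup>2) + (\<Sum>\<phi>\<in>\<Phi>. (\<phi> \<bullet> v)\<^sup>2)"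
proof -
  have sq: "a'\<^sup>2 + b'\<^sup>2 \<le> a\<^sup>2 + b\<^sup>2 \<and> (\<bar>a - b\<bar> > 1 \<longrightarrow> a'\<^sup>2 + b'\<^sup>2 < a\<^sup>2 + b\<^sup>2)"
    if "a' + b' = a + b" "\<bar>a' - b'\<bar> \<le> 1" for a b a' b' :: int
  proof -
    have *: "2 * (a\<^sup>2 + b\<^sup>2) = (a + b)\<^sup>2 + (a - b)\<^sup>2" for a b :: int
      by (simp add: power2_eq_square algebra_simps)
    have le: "\<bar>a' - b'\<bar> \<le> \<bar>a - b\<bar>" using that by presburger
    then have "(a' - b')\<^sup>2 \<le> (a - b)\<^sup>2" by (simp only: abs_le_square_iff)
    then have 1: "a'\<^sup>2 + b'\<^sup>2 \<le> a\<^sup>2 + b\<^sup>2" using *[of a b] *[of a' b'] that by simp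
    have "(a' - b')\<^sup>2 < (a - b)\<^sup>2" if "\<bar>a - b\<bar> > 1"
      using that \<open>\<bar>a' - b'\<bar> \<le> 1\<close> by (meson abs_le_square_iff not_less order.strict_trans1)
    then have 2: "\<bar>a - b\<bar> > 1 \<longrightarrow> a'\<^sup>2 + b'\<^sup>2 < a\<^sup>2 + b\<^sup>2"
      using *[of a b] *[of a' b'] that by auto
    show ?thesis using 1 2 by blast
  qed
  have main: "(\<phi> \<bullet> u')\<^sup>2 + (\<phi> \<bullet> v')\<^sup>2 \<le> (\<phi> \<bullet> u)\<^sup>2 + (\<phi> \<bullet> v)\<^sup>2 \<and>
      (\<bar>\<phi> \<bullet> u - \<phi> \<bullet> v\<bar> > 1 \<longrightarrow> (\<phi> \<bullet> u')\<^sup>2 + (\<phi> \<bullet> v')\<^sup>2 < (\<phi> \<bullet> u)\<^sup>2 + (\<phi> \<bullet> v)\<^sup>2)" if \<phi>: "\<phi> \<in> \<Phi>" for \<phi>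
  proof -
    obtain a b a' b' where ab: "\<phi> \<bullet> u = of_int a" "\<phi> \<bullet> v = of_int b" "\<phi> \<bullet> u' = of_int a'" "\<phi> \<bullet> v' = of_int b'"
      using inner_Ints[OF \<phi>] assms(1-4) by (metis Ints_cases)
    have "of_int a' + of_int b' = (of_int a + of_int b :: real)"
      using arg_cong[OF assms(5), of "\<lambda>x. \<phi> \<bullet> x"] by (simp add: inner_add_right ab)
    then have "a' + b' = a + b" by linarith
    moreover have "\<bar>a' - b'\<bar> \<le> 1"
      using assms(6) \<phi> unfolding close_def by (force simp: ab)
    ultimately show ?thesis
      using sq[of a' b' a b] unfolding ab
      by (metis (mono_tags, opaque_lifting) of_int_abs of_int_add of_int_diff of_int_le_iff
          of_int_less_iff of_int_power of_int_1)
  qed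
  obtain \<phi> where "\<phi> \<in> \<Phi>" "\<bar>\<phi> \<bullet> u - \<phi> \<bullet> v\<bar> > 1"
    using assms(7) by (auto simp: close_def not_le)
  then have "(\<Sum>\<phi>\<in>\<Phi>. (\<phi> \<bullet> u')\<^sup>2 + (\<phi> \<bullet> v')\<^sup>2) < (\<Sum>\<phi>\<in>\<Phi>. (\<phi> \<bullet> u)\<^sup>2 + (\<phi> \<bullet> v)\<^sup>2)"
    using fin\<Phi> main by (intro sum_strict_mono_ex1) auto
  then show ?thesis by (simp add: sum.distrib)
qed

text \<open>In a representation of \<open>x\<close> with minimal weighted sum of the heights \<open>F\<close>, two points of the
  support that are not close could be resolved, which would lower the sum.\<close>
lemma convex_hull_covered:
  assumes "x \<in> convex hull V"
  obtains \<sigma> where "clique \<sigma>" "x \<in> convex hull \<sigma>"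
proof -
  define F where "F v = (\<Sum>\<phi>\<in>\<Phi>. (\<phi> \<bullet> v)\<^sup>2)" for v
  define W where "W l \<longleftrightarrow> (\<forall>v\<in>V. 0 \<le> l v) \<and> sum l V = 1 \<and> (\<Sum>v\<in>V. l v *\<^sub>R v) = x"
    for l :: "real ^ 'n \<Rightarrow> real"
  define K where "K = convex hull ((\<lambda>v. (v, F v)) ` V)"
  have K: "K = {(\<Sum>v\<in>V. l v *\<^sub>R v, \<Sum>v\<in>V. l v *\<^sub>R F v) | l. (\<forall>v\<in>V. 0 \<le> l v) \<and> sum l V = 1}"
    unfolding K_def using finV by (rule convex_hull_graph_finite)
  define E where "E = K \<inter> ({x} \<times> UNIV)"
  have E: "E = {(x, \<Sum>v\<in>V. l v * F v) | l. W l}"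
    unfolding E_def K W_def by auto
  have "compact E" unfolding E_def K_def
    by (intro compact_Int_closed closed_Times finite_imp_compact_convex_hull finite_imageI finV) auto
  moreover have "E \<noteq> {}"
    using assms finV unfolding E W_def by (auto simp: convex_hull_finite)
  moreover have "continuous_on E snd" by (rule continuous_on_snd[OF continuous_on_id])
  ultimately obtain p where p: "p \<in> E" "\<forall>q\<in>E. snd p \<le> snd q"
    using continuous_attains_inf[of E snd] by blast
  then obtain l where l: "W l" "\<And>l'. W l' \<Longrightarrow> (\<Sum>v\<in>V. l v * F v) \<le> (\<Sum>v\<in>V. l' v * F v)"
    unfolding E by fastforce
  define \<sigma> where "\<sigma> = {v \<in> V. l v > 0}"
  have "close u v" if "u \<in> \<sigma>" "v \<in> \<sigma>" for u v
  proof (rule ccontr)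
    assume ncl: "\<not> close u v"
    then have "u \<noteq> v" using close_refl by blast
    have uv: "u \<in> V" "v \<in> V" "l u > 0" "l v > 0" using that by (auto simp: \<sigma>_def)
    obtain u' v' where u'v': "u' \<in> V" "v' \<in> V" "u' + v' = u + v" "close u' v'"
      using resolve[OF uv(1,2) ncl] by blast
    \<comment> \<open>The weight \<open>\<epsilon>\<close> is moved from \<open>u\<close> and \<open>v\<close> to \<open>u'\<close> and \<open>v'\<close>.\<close>
    define \<epsilon> where "\<epsilon> = min (l u) (l v)"
    have \<epsilon>: "\<epsilon> > 0" "\<epsilon> \<le> l u" "\<epsilon> \<le> l v" using uv by (auto simp: \<epsilon>_def)
    define d where "d a w = (if w = a then \<epsilon> else 0)" for a w :: "real ^ 'n"
    have dsum: "(\<Sum>w\<in>V. d a w * g w) = \<epsilon> * g a" if "a \<in> V" for a g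
      using that finV by (simp add: d_def if_distrib[of "\<lambda>x. x * _"] cong: if_cong)
    have dsum0: "(\<Sum>w\<in>V. d a w) = \<epsilon>" if "a \<in> V" for a
      using that finV by (simp add: d_def)
    have dsumv: "(\<Sum>w\<in>V. d a w *\<^sub>R w) = \<epsilon> *\<^sub>R a" if "a \<in> V" for a
      using that finV by (simp add: d_def if_distrib[of "\<lambda>x. x *\<^sub>R _"] cong: if_cong)
    define l' where "l' w = l w + d u' w + d v' w - d u w - d v w" for w
    have "0 \<le> l' w" if "w \<in> V" for w
      using \<epsilon> l(1) that \<open>u \<noteq> v\<close> by (auto simp: l'_def d_def W_def)
    moreover have "sum l' V = 1"
      using l(1) uv u'v' by (simp add: l'_def sum.distrib sum_subtractf dsum0 W_def)
    moreover have "(\<Sum>w\<in>V. l' w *\<^sub>R w) = x"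
    proof -
      have "(\<Sum>w\<in>V. l' w *\<^sub>R w) = x + \<epsilon> *\<^sub>R u' + \<epsilon> *\<^sub>R v' - \<epsilon> *\<^sub>R u - \<epsilon> *\<^sub>R v"
        using l(1) uv u'v'
        by (simp add: l'_def algebra_simps sum.distrib sum_subtractf dsumv W_def)
      also have "\<dots> = x + \<epsilon> *\<^sub>R (u' + v') - \<epsilon> *\<^sub>R (u + v)" by (simp add: algebra_simps)
      finally show ?thesis using u'v'(3) by simp
    qed
    ultimately have "W l'" by (simp add: W_def)
    then have "(\<Sum>w\<in>V. l w * F w) \<le> (\<Sum>w\<in>V. l' w * F w)" by (rule l(2))
    also have "\<dots> = (\<Sum>w\<in>V. l w * F w) + \<epsilon> * F u' + \<epsilon> * F v' - \<epsilon> * F u - \<epsilon> * F v"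
      using uv u'v' by (simp add: l'_def ring_distribs sum.distrib sum_subtractf dsum)
    finally have "\<epsilon> * (F u + F v) \<le> \<epsilon> * (F u' + F v')" by (simp add: algebra_simps)
    then have "F u + F v \<le> F u' + F v'" using \<epsilon>(1) by simp
    then show False
      using resolve_decreases_squares[OF uv(1,2) u'v'(1-4) ncl] by (simp add: F_def)
  qed
  then have "clique \<sigma>" by (auto simp: clique_def \<sigma>_def)
  moreover have "x \<in> convex hull \<sigma>"
    using convex_combination_in_hull_support[OF finV, of l] l(1) unfolding W_def \<sigma>_def by auto
  ultimately show ?thesis using that by blast
qed

text \<open>All vertices are within \<open>1\<close> of \<open>u\<close> under \<open>\<phi>\<close>, and \<open>u\<close> itself has positive weight, so the
  weighted mean is strictly closer than \<open>1\<close>.\<close>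
lemma support_close:
  assumes \<sigma>: "clique \<sigma>" and l: "\<And>v. v \<in> \<sigma> \<Longrightarrow> 0 \<le> l v" "sum l \<sigma> = 1" "(\<Sum>v\<in>\<sigma>. l v *\<^sub>R v) = x"
    and u: "u \<in> \<sigma>" "0 < l u" and \<phi>: "\<phi> \<in> \<Phi>"
  shows "\<bar>\<phi> \<bullet> u - \<phi> \<bullet> x\<bar> < 1"
proof -
  have fin: "finite \<sigma>" using \<sigma> by (rule clique_finite)
  have "\<phi> \<bullet> u - \<phi> \<bullet> x = (\<Sum>v\<in>\<sigma>. l v * (\<phi> \<bullet> u - \<phi> \<bullet> v))"
    using l(2) by (simp add: l(3)[symmetric] inner_sum_right right_diff_distrib sum_subtractf
        sum_distrib_right[symmetric])
  also have "\<dots> = (\<Sum>v\<in>\<sigma> - {u}. l v * (\<phi> \<bullet> u - \<phi> \<bullet> v))"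
    using fin u by (simp add: sum.remove)
  also have "\<bar>\<dots>\<bar> \<le> (\<Sum>v\<in>\<sigma> - {u}. l v * 1)"
    using \<sigma> u \<phi> l(1)
    by (intro order_trans[OF sum_abs] sum_mono)
      (auto simp: abs_mult clique_def close_def intro!: mult_left_le)
  also have "\<dots> = 1 - l u" using fin u l(2) by (simp add: sum_diff1)
  finally show ?thesis using u(2) by linarith
qed

text \<open>Let \<open>x\<close> lie in both hulls. The two supports of \<open>x\<close> are together a clique: across them, each
  form differs by less than \<open>2\<close>, hence by at most \<open>1\<close>. As this clique is affinely independent, \<open>x\<close>
  lies in the hull of the common vertices.\<close>
lemma clique_hull_Int:
  assumes \<sigma>: "clique \<sigma>" and \<tau>: "clique \<tau>"
  shows "convex hull \<sigma> \<inter> convex hull \<tau> = convex hull (\<sigma> \<inter> \<tau>)"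
proof (intro equalityI subsetI)
  fix x assume x: "x \<in> convex hull \<sigma> \<inter> convex hull \<tau>"
  obtain l where l: "\<And>v. v \<in> \<sigma> \<Longrightarrow> 0 \<le> l v" "sum l \<sigma> = 1" "(\<Sum>v\<in>\<sigma>. l v *\<^sub>R v) = x"
    using x clique_finite[OF \<sigma>] by (auto simp: convex_hull_finite)
  obtain m where m: "\<And>v. v \<in> \<tau> \<Longrightarrow> 0 \<le> m v" "sum m \<tau> = 1" "(\<Sum>v\<in>\<tau>. m v *\<^sub>R v) = x"
    using x clique_finite[OF \<tau>] by (auto simp: convex_hull_finite)
  define \<sigma>' \<tau>' where "\<sigma>' = {v\<in>\<sigma>. 0 < l v}" and "\<tau>' = {v\<in>\<tau>. 0 < m v}"
  have "x \<in> convex hull \<sigma>'" "x \<in> convex hull \<tau>'"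
    unfolding \<sigma>'_def \<tau>'_def
    using convex_combination_in_hull_support[OF clique_finite[OF \<sigma>], of l] l
      convex_combination_in_hull_support[OF clique_finite[OF \<tau>], of m] m by simp_all
  moreover have "clique (\<sigma>' \<union> \<tau>')"
  proof -
    have *: "close u v" if "u \<in> \<sigma>'" "v \<in> \<tau>'" for u v
      unfolding close_def
    proof
      fix \<phi> assume \<phi>: "\<phi> \<in> \<Phi>"
      have "\<bar>\<phi> \<bullet> u - \<phi> \<bullet> x\<bar> < 1" "\<bar>\<phi> \<bullet> v - \<phi> \<bullet> x\<bar> < 1"
        using support_close[OF \<sigma> l _ _ \<phi>, of u] support_close[OF \<tau> m _ _ \<phi>, of v] that
        by (auto simp: \<sigma>'_def \<tau>'_def)
      then have lt: "\<bar>\<phi> \<bullet> u - \<phi> \<bullet> v\<bar> < 2" by linarith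
      have "u \<in> V" "v \<in> V" using that \<sigma> \<tau> by (auto simp: \<sigma>'_def \<tau>'_def clique_def)
      then have "\<phi> \<bullet> u - \<phi> \<bullet> v \<in> \<int>" using inner_Ints[OF \<phi>] by auto
      then obtain k where k: "\<phi> \<bullet> u - \<phi> \<bullet> v = of_int k" by (rule Ints_cases)
      with lt have "\<bar>k\<bar> < 2" by linarith
      then show "\<bar>\<phi> \<bullet> u - \<phi> \<bullet> v\<bar> \<le> 1" unfolding k by linarith
    qed
    show ?thesis
      using \<sigma> \<tau> * close_sym unfolding clique_def \<sigma>'_def \<tau>'_def by blast
  qed
  ultimately have "x \<in> convex hull (\<sigma>' \<inter> \<tau>')"
    using convex_hull_Int[OF clique_affine_independent] by blast
  moreover have "\<sigma>' \<inter> \<tau>' \<subseteq> \<sigma> \<inter> \<tau>" by (auto simp: \<sigma>'_def \<tau>'_def)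
  ultimately show "x \<in> convex hull (\<sigma> \<inter> \<tau>)" using hull_mono by blast
next
  fix x assume "x \<in> convex hull (\<sigma> \<inter> \<tau>)"
  then show "x \<in> convex hull \<sigma> \<inter> convex hull \<tau>"
    using hull_mono[of "\<sigma> \<inter> \<tau>" \<sigma>] hull_mono[of "\<sigma> \<inter> \<tau>" \<tau>] by blast
qed

lemma Union_complex: "\<Union>complex = convex hull V"
proof
  show "\<Union>complex \<subseteq> convex hull V"
    unfolding complex_def clique_def by (auto intro: hull_mono[THEN subsetD])
  show "convex hull V \<subseteq> \<Union>complex"
    unfolding complex_def using convex_hull_covered by blast
qed

lemma clique_hull_Int_face:
  assumes "clique \<sigma>" "clique \<tau>"
  shows "(convex hull \<sigma> \<inter> convex hull \<tau>) face_of (convex hull \<sigma>)"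
  using clique_hull_Int[OF assms] face_of_convex_hull_affine_independent[OF clique_affine_independent]
    assms by blast

lemma finite_complex: "finite complex"
  unfolding complex_def
  by (rule finite_imageI, rule finite_subset[of _ "Pow V"]) (auto simp: clique_def finV)

lemma simplicial_complex_complex: "simplicial_complex complex"
  unfolding simplicial_complex_def
proof (intro conjI ballI allI impI)
  show "finite complex" by (rule finite_complex)
next
  fix S assume "S \<in> complex"
  then obtain \<sigma> where "clique \<sigma>" "S = convex hull \<sigma>" by (auto simp: complex_def)
  then show "\<exists>n. n simplex S"
    unfolding simplex_def using clique_affine_independent
    by (intro exI[of _ "int (card \<sigma>) - 1"] exI[of _ \<sigma>]) auto
next
  fix F S assume "S \<in> complex \<and> F face_of S"
  then obtain \<sigma> where \<sigma>: "clique \<sigma>" "F face_of convex hull \<sigma>" by (auto simp: complex_def)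
  then obtain \<tau> where "\<tau> \<subseteq> \<sigma>" "F = convex hull \<tau>"
    using face_of_convex_hull_affine_independent[OF clique_affine_independent] by blast
  then show "F \<in> complex" using clique_subset \<sigma>(1) by (auto simp: complex_def)
next
  fix S S' assume "S \<in> complex \<and> S' \<in> complex"
  then show "S \<inter> S' face_of S" using clique_hull_Int_face by (auto simp: complex_def)
qed

lemma complex_vertices_subset: "complex_vertices complex \<subseteq> V"
  unfolding complex_vertices_def complex_def clique_def
  by (auto dest!: extreme_point_of_convex_hull)

lemma lattice_triangulation_complex: "lattice_triangulation complex (convex hull V)"
  unfolding lattice_triangulation_def
  using simplicial_complex_complex Union_complex complex_vertices_subset intV by auto

lemma unimodular_complex: "unimodular_triangulation complex (convex hull V)"
  unfolding unimodular_triangulation_def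
proof (intro ballI impI)
  fix S assume "S \<in> complex" and dim: "aff_dim (convex hull V) simplex S"
  then obtain \<sigma> where \<sigma>: "clique \<sigma>" "S = convex hull \<sigma>" by (auto simp: complex_def)
  have "aff_dim S = aff_dim (convex hull V)" using dim by (rule aff_dim_simplex)
  then have dim_eq: "aff_dim \<sigma> = aff_dim V" using \<sigma> by (simp add: aff_dim_convex_hull)
  then have ne: "\<sigma> \<noteq> {}" using neV by (metis aff_dim_empty)
  have "\<sigma> \<subseteq> V" using \<sigma> by (simp add: clique_def)
  then have "affine hull \<sigma> = affine hull V"
    using dim_eq ne hull_mono[OF \<open>\<sigma> \<subseteq> V\<close>, of affine]
    by (intro affine_dim_equal) (auto simp: aff_dim_affine_hull)
  then have "affine hull (convex hull V) = affine hull \<sigma>" by (simp add: affine_hull_convex_hull)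
  moreover have "has_normalized_volume (integer_points \<inter> affine hull \<sigma>) (convex hull \<sigma>) 1"
    using clique_affine_independent[OF \<sigma>(1)] ne \<open>\<sigma> \<subseteq> V\<close> intV clique_coefficients_Ints[OF \<sigma>(1)]
    by (intro unimodular_simplex_volume) auto
  ultimately show "has_normalized_volume (integer_points \<inter> affine hull (convex hull V)) S 1"
    using \<sigma>(2) by simp
qed

lemma balanced_complex:
  assumes "\<And>v. v \<in> V \<Longrightarrow> int (col v) \<le> aff_dim V"
    and "\<And>u v. u \<in> V \<Longrightarrow> v \<in> V \<Longrightarrow> u \<noteq> v \<Longrightarrow> close u v \<Longrightarrow> col u \<noteq> col v"
  shows "balanced_triangulation complex (convex hull V)"
  unfolding balanced_triangulation_def
proof (intro exI[of _ col] conjI ballI allI impI)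
  fix v assume "v \<in> complex_vertices complex"
  then show "int (col v) < aff_dim (convex hull V) + 1"
    using assms(1)[of v] complex_vertices_subset by (auto simp: aff_dim_convex_hull)
next
  fix u v assume "u \<noteq> v \<and> closed_segment u v \<in> complex"
  then obtain \<sigma> where \<sigma>: "clique \<sigma>" "closed_segment u v = convex hull \<sigma>" "u \<noteq> v"
    by (auto simp: complex_def)
  have "u \<in> \<sigma>" "v \<in> \<sigma>"
    using extreme_point_of_segment[of _ u v] extreme_point_of_convex_hull[of _ \<sigma>] \<sigma>(2) by auto
  then show "col u \<noteq> col v" using assms(2)[of u v] \<sigma> by (auto simp: clique_def)
qed

text \<open>Each form maps a simplex into an interval \<open>[n, n + 1]\<close>, where the interpolation is affine. Two
  different maximal simplices contain vertices \<open>u\<close> and \<open>v\<close> that are not close, for otherwise their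
  vertices together would span a larger simplex. The midpoint of \<open>u\<close> and \<open>v\<close> need not lie in either
  of the two simplices, so the affine function has to be compared with \<open>f\<close> outside of them.\<close>
lemma regular_complex: "regular_triangulation complex (convex hull V)"
proof -
  define f where "f x = (\<Sum>\<phi>\<in>\<Phi>. interp_square (\<phi> \<bullet> x))" for x
  have conv1: "convex_on UNIV (\<lambda>x. interp_square (\<phi> \<bullet> x))" for \<phi> :: "real ^ 'n"
  proof (intro convex_onI)
    fix t x y assume "0 < (t::real)" "t < 1"
    then show "interp_square (\<phi> \<bullet> ((1 - t) *\<^sub>R x + t *\<^sub>R y))
        \<le> (1 - t) * interp_square (\<phi> \<bullet> x) + t * interp_square (\<phi> \<bullet> y)"
      using convex_onD[OF convex_on_interp_square, of t "\<phi> \<bullet> x" "\<phi> \<bullet> y"]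
      by (simp add: inner_add_right)
  qed auto
  have convf: "convex_on UNIV f"
    unfolding f_def
    using fin\<Phi> by (induction rule: finite_induct) (auto intro: convex_on_add conv1 simp: convex_on_const)
  have convfQ: "convex_on (convex hull V) f"
    using convf by (rule convex_on_subset) auto
  have aff: "affine_function_on S f" if S: "S \<in> complex" for S
  proof -
    obtain \<sigma> where \<sigma>: "clique \<sigma>" "S = convex hull \<sigma>" using S by (auto simp: complex_def)
    have "\<exists>n::int. \<forall>x\<in>S. of_int n \<le> \<phi> \<bullet> x \<and> \<phi> \<bullet> x \<le> of_int n + 1" if \<phi>: "\<phi> \<in> \<Phi>" for \<phi>
    proof (cases "\<sigma> = {}")
      case False
      have fin: "finite \<sigma>" using \<sigma>(1) by (rule clique_finite)
      obtain w where w: "w \<in> \<sigma>" "\<forall>v\<in>\<sigma>. \<phi> \<bullet> w \<le> \<phi> \<bullet> v"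
        using that[of "arg_min_on (\<lambda>v. \<phi> \<bullet> v) \<sigma>"] arg_min_if_finite(1)[OF fin False]
          arg_min_least[OF fin False] by blast
      obtain n where n: "\<phi> \<bullet> w = of_int n"
        using inner_Ints[OF \<phi>, of w] w(1) \<sigma>(1) by (auto simp: clique_def elim: Ints_cases)
      have "\<sigma> \<subseteq> {x. of_int n \<le> \<phi> \<bullet> x} \<inter> {x. \<phi> \<bullet> x \<le> of_int n + 1}"
        using w \<sigma>(1) \<phi> by (force simp: n[symmetric] clique_def close_def)
      moreover have "convex ({x. of_int n \<le> \<phi> \<bullet> x} \<inter> {x. \<phi> \<bullet> x \<le> of_int n + 1})"
        by (intro convex_Int convex_halfspace_le convex_halfspace_ge)
      ultimately have "S \<subseteq> {x. of_int n \<le> \<phi> \<bullet> x} \<inter> {x. \<phi> \<bullet> x \<le> of_int n + 1}"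
        unfolding \<sigma>(2) by (rule hull_minimal)
      then show ?thesis by blast
    qed (simp add: \<sigma>)
    then obtain n :: "real ^ 'n \<Rightarrow> int" where
      n: "\<And>\<phi> x. \<phi> \<in> \<Phi> \<Longrightarrow> x \<in> S \<Longrightarrow> of_int (n \<phi>) \<le> \<phi> \<bullet> x \<and> \<phi> \<bullet> x \<le> of_int (n \<phi>) + 1"
      by metis
    show ?thesis
      unfolding affine_function_on_def
    proof (intro exI ballI)
      fix x assume "x \<in> S"
      then have "f x = (\<Sum>\<phi>\<in>\<Phi>. (2 * of_int (n \<phi>) + 1) * (\<phi> \<bullet> x) - of_int (n \<phi>) * (of_int (n \<phi>) + 1))"
        unfolding f_def using n by (intro sum.cong interp_square_eq) auto
      then show "f x = (\<Sum>\<phi>\<in>\<Phi>. (2 * of_int (n \<phi>) + 1) *\<^sub>R \<phi>) \<bullet> x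
          + (- (\<Sum>\<phi>\<in>\<Phi>. of_int (n \<phi>) * (of_int (n \<phi>) + 1)))"
        by (simp add: inner_sum_left sum_subtractf)
    qed
  qed
  have "\<not> affine_function_on (S \<union> S') f"
    if S: "S \<in> maximal_simplices complex" and S': "S' \<in> maximal_simplices complex" and ne: "S \<noteq> S'" for S S'
  proof
    assume "affine_function_on (S \<union> S') f"
    then obtain a c where L: "\<And>x. x \<in> S \<union> S' \<Longrightarrow> f x = a \<bullet> x + c"
      by (auto simp: affine_function_on_def)
    obtain \<sigma> \<tau> where \<sigma>: "clique \<sigma>" "S = convex hull \<sigma>" and \<tau>: "clique \<tau>" "S' = convex hull \<tau>"
      using S S' by (auto simp: complex_def maximal_simplices_def)
    have "\<exists>u\<in>\<sigma>. \<exists>v\<in>\<tau>. \<not> close u v"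
    proof (rule ccontr)
      assume "\<not> ?thesis"
      then have "clique (\<sigma> \<union> \<tau>)"
        using \<sigma>(1) \<tau>(1) close_sym unfolding clique_def by blast
      then have "convex hull (\<sigma> \<union> \<tau>) \<in> complex" by (auto simp: complex_def)
      moreover have "S \<subseteq> convex hull (\<sigma> \<union> \<tau>)" "S' \<subseteq> convex hull (\<sigma> \<union> \<tau>)"
        unfolding \<sigma> \<tau> by (auto intro!: hull_mono)
      ultimately show False using S S' ne unfolding maximal_simplices_def by blast
    qed
    then obtain u v where uv: "u \<in> \<sigma>" "v \<in> \<tau>" "\<not> close u v" by blast
    then have uvV: "u \<in> V" "v \<in> V" using \<sigma>(1) \<tau>(1) by (auto simp: clique_def)
    have uS: "u \<in> S" "v \<in> S'" using uv \<sigma>(2) \<tau>(2) by (auto intro: hull_inc)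
    define m where "m = (1/2) *\<^sub>R u + (1/2) *\<^sub>R v"
    have m: "\<phi> \<bullet> m = (\<phi> \<bullet> u + \<phi> \<bullet> v) / 2" for \<phi>
      by (simp add: m_def inner_add_right)
    have "m \<in> convex hull V"
      unfolding m_def using uvV by (intro convexD) (auto intro: hull_inc)
    then have mU: "m \<in> \<Union>complex" by (simp add: Union_complex)
    have cl: "closed S''" if "S'' \<in> complex" for S''
      using that clique_finite
      by (auto simp: complex_def intro!: compact_imp_closed finite_imp_compact_convex_hull)
    have face: "S \<inter> S' face_of S" if "S \<in> complex" "S' \<in> complex" for S S'
      using that clique_hull_Int_face by (auto simp: complex_def)
    have "a \<bullet> m + c \<le> f m"
      by (rule affine_minorant_of_maximal_simplex[OF finite_complex cl face _ S _ _ _ mU])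
        (use \<sigma> uS L convfQ in \<open>auto simp: Union_complex\<close>)
    moreover have "a \<bullet> m + c = (f u + f v) / 2"
      using L uS by (simp add: m)
    moreover have "f m < (f u + f v) / 2"
    proof -
      have "f m < (\<Sum>\<phi>\<in>\<Phi>. (interp_square (\<phi> \<bullet> u) + interp_square (\<phi> \<bullet> v)) / 2)"
        unfolding f_def
      proof (rule sum_strict_mono_ex1[OF fin\<Phi>])
        show "\<forall>\<phi>\<in>\<Phi>. interp_square (\<phi> \<bullet> m) \<le> (interp_square (\<phi> \<bullet> u) + interp_square (\<phi> \<bullet> v)) / 2"
        proof
          fix \<phi>
          show "interp_square (\<phi> \<bullet> m) \<le> (interp_square (\<phi> \<bullet> u) + interp_square (\<phi> \<bullet> v)) / 2"
            using convex_onD[OF conv1, of "1/2" u v \<phi>] by (simp add: m_def add_divide_distrib)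
        qed
        obtain \<phi> where \<phi>: "\<phi> \<in> \<Phi>" "\<bar>\<phi> \<bullet> u - \<phi> \<bullet> v\<bar> > 1"
          using uv(3) by (auto simp: close_def not_le)
        then show "\<exists>\<phi>\<in>\<Phi>. interp_square (\<phi> \<bullet> m) < (interp_square (\<phi> \<bullet> u) + interp_square (\<phi> \<bullet> v)) / 2"
          using interp_square_midpoint_less inner_Ints uvV by (intro bexI[of _ \<phi>]) (auto simp: m)
      qed
      also have "\<dots> = (f u + f v) / 2"
        by (simp add: f_def sum.distrib sum_divide_distrib[symmetric])
      finally show ?thesis .
    qed
    ultimately show False by simp
  qed
  then show ?thesis
    unfolding regular_triangulation_def
    using convfQ aff by (intro exI[of _ f]) auto
qed

lemma has_triangulation:
  assumes "\<And>v. v \<in> V \<Longrightarrow> int (col v) \<le> aff_dim V"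
    and "\<And>u v. u \<in> V \<Longrightarrow> v \<in> V \<Longrightarrow> u \<noteq> v \<Longrightarrow> close u v \<Longrightarrow> col u \<noteq> col v"
  shows "has_regular_unimodular_balanced_triangulation (convex hull V)"
proof -
  have "balanced_triangulation complex (convex hull V)"
    by (rule balanced_complex[of col]) (use assms in auto)
  then show ?thesis
    unfolding has_regular_unimodular_balanced_triangulation_def
    using lattice_triangulation_complex regular_complex unimodular_complex by blast
qed

end

section \<open>Triangulations by alcoves\<close>

lemma finite_obtains_max:
  fixes f :: "'a \<Rightarrow> real"
  assumes "finite A" "A \<noteq> {}"
  obtains a where "a \<in> A" "\<And>b. b \<in> A \<Longrightarrow> f b \<le> f a"
  using that[of "arg_min_on (\<lambda>a. - f a) A"] arg_min_if_finite(1)[OF assms]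
    arg_min_least[OF assms, of _ "\<lambda>a. - f a"] by force

text \<open>The functionals \<open>y i\<close> are integral coordinates that separate the points of \<open>V\<close>. As one of
  them is \<open>0\<close>, closeness with respect to their differences means that one point is below the other
  in all coordinates, by at most \<open>1\<close>. The sum \<open>s\<close> of the coordinates therefore orders each
  clique, and along a clique it grows by at most the number of nonconstant coordinates; hence its
  residues modulo the dimension plus one are distinct on each simplex.\<close>
lemma alcove_triangulation:
  fixes V :: "(real ^ 'n) set" and y :: "'i \<Rightarrow> real ^ 'n"
  assumes finI: "finite I" and V: "finite V" "V \<noteq> {}" "V \<subseteq> integer_points"
    and y: "\<And>i. i \<in> I \<Longrightarrow> y i \<in> integer_points" and i0: "i0 \<in> I" "y i0 = 0"
    and sep: "\<And>u v. \<lbrakk>u \<in> V; v \<in> V; \<And>i. i \<in> I \<Longrightarrow> y i \<bullet> u = y i \<bullet> v\<rbrakk> \<Longrightarrow> u = v"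
    and mid: "\<And>u v. \<lbrakk>u \<in> V; v \<in> V\<rbrakk> \<Longrightarrow>
      \<exists>u'\<in>V. u + v - u' \<in> V \<and> (\<forall>i\<in>I. y i \<bullet> u' = of_int \<lfloor>(y i \<bullet> (u + v)) / 2\<rfloor>)"
    and dim: "int (card {i\<in>I. \<exists>u\<in>V. \<exists>v\<in>V. y i \<bullet> u \<noteq> y i \<bullet> v}) \<le> aff_dim V"
  shows "has_regular_unimodular_balanced_triangulation (convex hull V)"
proof -
  define \<Phi> where "\<Phi> = (\<lambda>(i, j). y i - y j) ` (I \<times> I)"
  interpret close_points \<Phi> V
    using finI V y by unfold_locales (auto simp: \<Phi>_def intro: integer_points_diff)
  have y\<Phi>: "y i \<in> \<Phi>" if "i \<in> I" for i
    unfolding \<Phi>_def using that i0 by (intro image_eqI[of _ _ "(i, i0)"]) auto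
  have yint: "y i \<bullet> v \<in> \<int>" if "i \<in> I" "v \<in> V" for i v
    using inner_Ints[OF y\<Phi>] that by blast
  have close_iff: "close u v \<longleftrightarrow>
      (\<forall>i\<in>I. \<forall>j\<in>I. \<bar>(y i \<bullet> u - y i \<bullet> v) - (y j \<bullet> u - y j \<bullet> v)\<bar> \<le> 1)" for u v
    unfolding close_def by (simp add: \<Phi>_def inner_diff_left algebra_simps)
  have close1: "\<bar>y i \<bullet> u - y i \<bullet> v\<bar> \<le> 1" if "close u v" "i \<in> I" for i u v
    using that y\<Phi> unfolding close_def by blast
  define s where "s v = (\<Sum>i\<in>I. y i \<bullet> v)" for v
  have le: "y i \<bullet> u \<le> y i \<bullet> v"
    if uv: "u \<in> V" "v \<in> V" "close u v" "s u \<le> s v" and i: "i \<in> I" for u v i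
  proof (rule ccontr)
    assume "\<not> y i \<bullet> u \<le> y i \<bullet> v"
    then have gt: "y i \<bullet> v < y i \<bullet> u" by simp
    have "y i \<bullet> u - y i \<bullet> v \<in> \<int>" using yint i uv by simp
    then obtain k where k: "y i \<bullet> u - y i \<bullet> v = of_int k" by (rule Ints_cases)
    with gt have "1 \<le> k" by simp
    then have ge1: "1 \<le> y i \<bullet> u - y i \<bullet> v" unfolding k by simp
    have "y j \<bullet> v \<le> y j \<bullet> u" if "j \<in> I" for j
    proof -
      have "\<bar>(y i \<bullet> u - y i \<bullet> v) - (y j \<bullet> u - y j \<bullet> v)\<bar> \<le> 1"
        using uv(3) i that unfolding close_iff by blast
      then show ?thesis using ge1 by linarith
    qed
    then have "s v < s u" unfolding s_def using gt i finI by (intro sum_strict_mono_ex1) auto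
    then show False using uv by simp
  qed
  interpret close_points_triangulation \<Phi> V
  proof
    fix u v assume uv: "u \<in> V" "v \<in> V"
    then obtain u' where u': "u' \<in> V" "u + v - u' \<in> V"
      "\<And>i. i \<in> I \<Longrightarrow> y i \<bullet> u' = of_int \<lfloor>(y i \<bullet> (u + v)) / 2\<rfloor>" using mid by blast
    \<comment> \<open>In each coordinate, the rounded down and rounded up midpoints differ by \<open>0\<close> or \<open>1\<close>.\<close>
    have d: "-1 \<le> y i \<bullet> u' - y i \<bullet> (u + v - u') \<and> y i \<bullet> u' - y i \<bullet> (u + v - u') \<le> 0"
      if "i \<in> I" for i
    proof -
      have "y i \<bullet> (u + v) \<in> \<int>" using yint that uv by (simp add: inner_add_right)
      then obtain t where t: "y i \<bullet> (u + v) = of_int t" by (rule Ints_cases)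
      have "\<lfloor>(y i \<bullet> (u + v)) / 2\<rfloor> = t div 2"
        unfolding t by (metis floor_divide_of_int_eq of_int_numeral)
      then have "y i \<bullet> u' - y i \<bullet> (u + v - u') = of_int (2 * (t div 2) - t)"
        using u'(3)[OF that] t by (simp add: inner_diff_right)
      moreover have "-1 \<le> 2 * (t div 2) - t" "2 * (t div 2) - t \<le> 0" by presburger+
      ultimately show ?thesis by linarith
    qed
    have "close u' (u + v - u')"
      unfolding close_iff
    proof (intro ballI)
      fix i j assume "i \<in> I" "j \<in> I"
      then show "\<bar>y i \<bullet> u' - y i \<bullet> (u + v - u') - (y j \<bullet> u' - y j \<bullet> (u + v - u'))\<bar> \<le> 1"
        using d[of i] d[of j] by linarith
    qed
    then show "\<exists>u'\<in>V. \<exists>v'\<in>V. u' + v' = u + v \<and> close u' v'"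
      using u' by (intro bexI[of _ u'] bexI[of _ "u + v - u'"]) auto
  next
    fix \<sigma> u w assume \<sigma>: "clique \<sigma>" "u \<in> \<sigma>" "w \<in> \<sigma>" "u \<noteq> w"
    have fin: "finite \<sigma>" using \<sigma>(1) by (rule clique_finite)
    \<comment> \<open>A coordinate that tells the top vertex \<open>v\<close> from the next one \<open>v2\<close> has already dropped
      by \<open>1\<close> at \<open>v2\<close>, so it stays constant on all lower vertices.\<close>
    obtain v where v: "v \<in> \<sigma>" "\<And>w. w \<in> \<sigma> \<Longrightarrow> s w \<le> s v"
      using finite_obtains_max[OF fin, of s] \<sigma>(2) by blast
    have "\<sigma> - {v} \<noteq> {}" using \<sigma> by blast
    then obtain v2 where v2: "v2 \<in> \<sigma> - {v}" "\<And>w. w \<in> \<sigma> - {v} \<Longrightarrow> s w \<le> s v2"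
      using finite_obtains_max[of "\<sigma> - {v}" s] fin by blast
    have V': "w \<in> V" if "w \<in> \<sigma>" for w using \<sigma>(1) that by (auto simp: clique_def)
    have cl: "close a b" if "a \<in> \<sigma>" "b \<in> \<sigma>" for a b using \<sigma>(1) that by (auto simp: clique_def)
    obtain i where i: "i \<in> I" "y i \<bullet> v \<noteq> y i \<bullet> v2" using sep[of v v2] v(1) v2(1) V' by blast
    have "y i \<bullet> v2 \<le> y i \<bullet> v" using le v v2 V' cl i by blast
    then have lt: "y i \<bullet> v2 < y i \<bullet> v" using i by simp
    have "y i \<bullet> v - y i \<bullet> v2 \<in> \<int>" using yint i V' v v2 by simp
    then obtain k where k: "y i \<bullet> v - y i \<bullet> v2 = of_int k" by (rule Ints_cases)
    have "k \<ge> 1" using lt k by simp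
    then have ge1: "1 \<le> y i \<bullet> v - y i \<bullet> v2" unfolding k by simp
    have "y i \<bullet> w = y i \<bullet> v2" if w: "w \<in> \<sigma> - {v}" for w
    proof -
      have "y i \<bullet> w \<le> y i \<bullet> v2" using le[of w v2 i] w v2 V' cl i by blast
      moreover have "\<bar>y i \<bullet> v - y i \<bullet> w\<bar> \<le> 1" using close1 cl v w i by blast
      ultimately show ?thesis using ge1 by linarith
    qed
    moreover have "\<bar>y i \<bullet> v - y i \<bullet> v2\<bar> = 1"
      using close1[of v v2 i] cl v v2 i ge1 by auto
    ultimately show "\<exists>v\<in>\<sigma>. \<exists>\<phi>\<in>\<Phi>. \<exists>n. \<bar>\<phi> \<bullet> v - n\<bar> = 1 \<and> (\<forall>w\<in>\<sigma> - {v}. \<phi> \<bullet> w = n)"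
      using v(1) y\<Phi>[OF i(1)] by blast
  qed
  define N where "N = {i\<in>I. \<exists>u\<in>V. \<exists>v\<in>V. y i \<bullet> u \<noteq> y i \<bullet> v}"
  define M where "M = aff_dim V + 1"
  have M: "int (card N) < M" using dim by (simp add: M_def N_def)
  then have Mpos: "0 < M" by linarith
  define col where "col v = nat (\<lfloor>s v\<rfloor> mod M)" for v
  have int_col: "int (col v) = \<lfloor>s v\<rfloor> mod M" for v
    using Mpos by (simp add: col_def)
  have ne: "col u \<noteq> col v" if uv: "u \<in> V" "v \<in> V" "u \<noteq> v" "close u v" "s u \<le> s v" for u v
  proof
    assume eq: "col u = col v"
    have sint: "s w = of_int \<lfloor>s w\<rfloor>" if "w \<in> V" for w
    proof -
      have "s w \<in> \<int>" unfolding s_def using yint that by (intro Ints_sum) auto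
      then show ?thesis by (metis Ints_cases floor_of_int)
    qed
    have "s v - s u = (\<Sum>i\<in>I. y i \<bullet> v - y i \<bullet> u)" by (simp add: s_def sum_subtractf)
    also have "\<dots> = (\<Sum>i\<in>N. y i \<bullet> v - y i \<bullet> u)"
    proof (intro sum.mono_neutral_right finI ballI)
      show "N \<subseteq> I" unfolding N_def by blast
      fix i assume "i \<in> I - N"
      then have "y i \<bullet> v = y i \<bullet> u" unfolding N_def using uv by blast
      then show "y i \<bullet> v - y i \<bullet> u = 0" by simp
    qed
    also have "\<dots> \<le> (\<Sum>i\<in>N. 1)"
    proof (rule sum_mono)
      fix i assume "i \<in> N"
      then show "y i \<bullet> v - y i \<bullet> u \<le> 1" using close1[OF uv(4), of i] by (simp add: N_def)
    qed
    finally have "s v - s u \<le> card N" by simp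
    moreover have "s u < s v"
    proof -
      obtain i where "i \<in> I" "y i \<bullet> u \<noteq> y i \<bullet> v" using sep[OF uv(1,2)] uv(3) by blast
      moreover have "y j \<bullet> u \<le> y j \<bullet> v" if "j \<in> I" for j
        using le[OF uv(1,2,4,5) that] .
      ultimately show ?thesis
        unfolding s_def using finI by (intro sum_strict_mono_ex1) (auto simp: less_le)
    qed
    ultimately have k: "0 < \<lfloor>s v\<rfloor> - \<lfloor>s u\<rfloor>" "\<lfloor>s v\<rfloor> - \<lfloor>s u\<rfloor> \<le> int (card N)"
      using sint[OF uv(1)] sint[OF uv(2)] by linarith+
    have "\<lfloor>s v\<rfloor> mod M = \<lfloor>s u\<rfloor> mod M" using int_col[of u] int_col[of v] eq by simp
    then have "M dvd \<lfloor>s v\<rfloor> - \<lfloor>s u\<rfloor>" by (simp add: mod_eq_dvd_iff)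
    then have "M \<le> \<lfloor>s v\<rfloor> - \<lfloor>s u\<rfloor>" using k(1) zdvd_imp_le by blast
    then show False using k(2) M by linarith
  qed
  show ?thesis
  proof (rule has_triangulation[of col])
    fix v assume "v \<in> V"
    have "\<lfloor>s v\<rfloor> mod M < M" using Mpos by simp
    then show "int (col v) \<le> aff_dim V" by (simp add: int_col M_def)
  next
    fix u v assume "u \<in> V" "v \<in> V" "u \<noteq> v" "close u v"
    then show "col u \<noteq> col v" using ne[of u v] ne[of v u] close_sym by (metis linear)
  qed
qed

lemma aff_dim_ge_dim_differences:
  fixes S :: "(real ^ 'n) set"
  assumes "S \<noteq> {}" "\<And>d. d \<in> D \<Longrightarrow> \<exists>x\<in>S. \<exists>y\<in>S. d = x - y"
  shows "int (dim D) \<le> aff_dim S"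
proof -
  obtain a where a: "a \<in> S" using assms(1) by blast
  have "D \<subseteq> span ((\<lambda>x. x - a) ` S)"
  proof
    fix d assume "d \<in> D"
    then obtain x y where xy: "x \<in> S" "y \<in> S" "d = (x - a) - (y - a)"
      using assms(2) by fastforce
    show "d \<in> span ((\<lambda>x. x - a) ` S)"
      unfolding xy(3) using xy(1,2) by (intro span_diff span_base) auto
  qed
  then have "dim D \<le> dim ((\<lambda>x. x - a) ` S)" by (rule dim_mono)
  then show ?thesis using aff_dim_eq_dim_subtract[of a S] a by (simp add: hull_inc)
qed

lemma dim_Basis_cart: "dim (Basis :: (real ^ 'n) set) = CARD('n)"
  by (simp add: dim_eq_card_independent independent_Basis)

lemma finite_vectors_with_entries:
  assumes "finite A"
  shows "finite {x :: real ^ 'n. \<forall>i. x $ i \<in> A}"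
proof (rule finite_subset)
  show "{x :: real ^ 'n. \<forall>i. x $ i \<in> A} \<subseteq> (\<lambda>f. \<chi> i. f i) ` (UNIV \<rightarrow>\<^sub>E A)"
  proof
    fix x :: "real ^ 'n" assume "x \<in> {x. \<forall>i. x $ i \<in> A}"
    then show "x \<in> (\<lambda>f. \<chi> i. f i) ` (UNIV \<rightarrow>\<^sub>E A)"
      by (intro image_eqI[of _ _ "\<lambda>i. x $ i"]) auto
  qed
  show "finite ((\<lambda>f. \<chi> i. f i :: real ^ 'n) ` (UNIV \<rightarrow>\<^sub>E A))"
    using assms by (intro finite_imageI finite_PiE) auto
qed

text \<open>The linear form \<open>x \<mapsto> coord0 x i\<close> as a vector.\<close>
definition unit0 :: "'n option \<Rightarrow> real ^ 'n" where
  "unit0 i = (case i of None \<Rightarrow> 0 | Some j \<Rightarrow> axis j 1)"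

lemma unit0_inner: "unit0 i \<bullet> x = coord0 x i"
  by (cases i) (auto simp: unit0_def coord0_def inner_axis')

lemma unit0_inj: "unit0 i = (unit0 j :: real ^ 'n) \<Longrightarrow> i = j"
  by (cases i; cases j) (auto simp: unit0_def axis_eq_axis axis_eq_0_iff dest: sym)

lemma unit0_integer: "unit0 i \<in> integer_points"
  by (cases i) (auto simp: unit0_def integer_points_def axis_def)

lemma coordinate_alcove_triangulation:
  fixes V :: "(real ^ 'n) set"
  assumes V: "finite V" "V \<noteq> {}" "V \<subseteq> integer_points"
    and mid: "\<And>u v. \<lbrakk>u \<in> V; v \<in> V\<rbrakk> \<Longrightarrow>
      (\<chi> i. of_int \<lfloor>(u $ i + v $ i) / 2\<rfloor>) \<in> V \<and> u + v - (\<chi> i. of_int \<lfloor>(u $ i + v $ i) / 2\<rfloor>) \<in> V"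
    and dim: "int (card {i. \<exists>u\<in>V. \<exists>v\<in>V. u $ i \<noteq> v $ i}) \<le> aff_dim V"
  shows "has_regular_unimodular_balanced_triangulation (convex hull V)"
proof (rule alcove_triangulation[of UNIV V unit0 None])
  fix u v assume uv: "u \<in> V" "v \<in> V"
  show "u = v" if "\<And>i. i \<in> UNIV \<Longrightarrow> unit0 i \<bullet> u = unit0 i \<bullet> v"
    using that[of "Some _"] by (simp add: unit0_inner coord0_def vec_eq_iff)
  show "\<exists>u'\<in>V. u + v - u' \<in> V \<and> (\<forall>i\<in>UNIV. unit0 i \<bullet> u' = of_int \<lfloor>unit0 i \<bullet> (u + v) / 2\<rfloor>)"
    using mid[OF uv]
    by (intro bexI[of _ "\<chi> i. of_int \<lfloor>(u $ i + v $ i) / 2\<rfloor>"])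
      (auto simp: unit0_inner coord0_def split: option.split)
next
  have "{i \<in> UNIV. \<exists>u\<in>V. \<exists>v\<in>V. unit0 i \<bullet> u \<noteq> unit0 i \<bullet> v} = Some ` {i. \<exists>u\<in>V. \<exists>v\<in>V. u $ i \<noteq> v $ i}"
  proof (rule set_eqI)
    fix i
    show "i \<in> {i \<in> UNIV. \<exists>u\<in>V. \<exists>v\<in>V. unit0 i \<bullet> u \<noteq> unit0 i \<bullet> v} \<longleftrightarrow>
        i \<in> Some ` {i. \<exists>u\<in>V. \<exists>v\<in>V. u $ i \<noteq> v $ i}"
      by (cases i) (auto simp: unit0_inner coord0_def)
  qed
  then show "int (card {i \<in> UNIV. \<exists>u\<in>V. \<exists>v\<in>V. unit0 i \<bullet> u \<noteq> unit0 i \<bullet> v}) \<le> aff_dim V"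
    using dim by (simp add: card_image)
qed (use V unit0_integer in \<open>auto simp: unit0_def\<close>)

section \<open>Order polytopes\<close>

lemma convex_order_polytope: "convex (order_polytope P r)"
  unfolding order_polytope_def convex_alt
  by (auto intro!: add_mono mult_left_mono convex_bound_le)

lemma compact_order_polytope: "compact (order_polytope P r)"
proof -
  have "closed (order_polytope P r)"
    unfolding order_polytope_def Ball_def
    by (intro closed_Collect_conj closed_Collect_all closed_Collect_imp closed_Collect_le
        closed_Collect_eq open_Collect_const continuous_intros)
  moreover have "order_polytope P r \<subseteq> cbox 0 1"
    by (force simp: order_polytope_def mem_box_cart)
  then have "bounded (order_polytope P r)" using bounded_cbox bounded_subset by blast
  ultimately show ?thesis by (simp add: compact_eq_bounded_closed)
qed

text \<open>The maps \<open>t \<mapsto> t\<^sup>2\<close> and \<open>t \<mapsto> 2 t - t\<^sup>2\<close> are increasing bijections of \<open>[0, 1]\<close>, so they preserve the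
  order polytope when applied to all coordinates. As their mean is the identity, they fix the
  coordinates of an extreme point.\<close>
lemma extreme_point_order_polytope:
  assumes "x extreme_point_of order_polytope P r"
  shows "x $ i \<in> {0, 1}"
proof -
  define a b where "a = (\<chi> i. (x $ i)\<^sup>2)" and "b = (\<chi> i. 2 * x $ i - (x $ i)\<^sup>2)"
  have x: "x \<in> order_polytope P r" using assms by (simp add: extreme_point_of_def)
  have mono: "2 * s - s\<^sup>2 \<le> 2 * t - t\<^sup>2" if "s \<le> t" "t \<le> 1" for s t :: real
  proof -
    have "0 \<le> (t - s) * (2 - t - s)" using that by (intro mult_nonneg_nonneg) auto
    then show ?thesis by (simp add: power2_eq_square algebra_simps)
  qed
  have "a \<in> order_polytope P r"
    using x unfolding order_polytope_def a_def by (auto intro: power_mono power_le_one)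
  moreover have "b \<in> order_polytope P r"
    using x mono[of 0] mono[of _ 1] mono unfolding order_polytope_def b_def by auto
  moreover have "x = midpoint a b"
    by (simp add: vec_eq_iff midpoint_def a_def b_def)
  ultimately have "midpoint a b \<notin> open_segment a b"
    using assms unfolding extreme_point_of_def by blast
  then have "a = b" by simp
  then have "(x $ i)\<^sup>2 = 2 * x $ i - (x $ i)\<^sup>2" by (simp add: vec_eq_iff a_def b_def)
  then have "x $ i * (x $ i - 1) = 0" by (simp add: power2_eq_square algebra_simps)
  then show ?thesis by simp
qed

text \<open>The rounded midpoints of two vertices are their minimum and maximum. The dimension is
  \<open>card P\<close>, as each unit vector \<open>axis a 1\<close> is the difference of the indicator vectors of
  two upper sets, namely the principal one of \<open>a\<close>, with and without \<open>a\<close>.\<close>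
theorem order_polytope_triangulation:
  fixes P :: "'p::finite set"
  assumes r: "partial_order_on P r"
  shows "has_regular_unimodular_balanced_triangulation (order_polytope P r)"
proof -
  define V where "V = {x \<in> order_polytope P r. \<forall>i. x $ i \<in> {0, 1}}"
  have "order_polytope P r = convex hull {x. x extreme_point_of order_polytope P r}"
    by (intro Krein_Milman_Minkowski compact_order_polytope convex_order_polytope)
  also have "\<dots> \<subseteq> convex hull V"
    using extreme_point_order_polytope by (intro hull_mono) (auto simp: V_def extreme_point_of_def)
  finally have "convex hull V = order_polytope P r"
    using hull_minimal[of V "order_polytope P r" convex] convex_order_polytope by (auto simp: V_def)
  moreover have "has_regular_unimodular_balanced_triangulation (convex hull V)"
  proof (rule coordinate_alcove_triangulation)
    show "finite V"
      by (rule finite_subset[OF _ finite_vectors_with_entries[of "{0, 1}"]]) (auto simp: V_def)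
    have "0 \<in> V" by (auto simp: V_def order_polytope_def)
    then show ne: "V \<noteq> {}" by blast
    show "V \<subseteq> integer_points"
    proof
      fix x assume "x \<in> V"
      then have 01: "x $ i = 0 \<or> x $ i = 1" for i by (auto simp: V_def)
      have "x $ i \<in> \<int>" for i using 01[of i] by auto
      then show "x \<in> integer_points" by (simp add: integer_points_def)
    qed
  next
    fix u v assume uv: "u \<in> V" "v \<in> V"
    have 01: "u $ i = 0 \<or> u $ i = 1" "v $ i = 0 \<or> v $ i = 1" for i using uv by (auto simp: V_def)
    have "(\<chi> i. of_int \<lfloor>(u $ i + v $ i) / 2\<rfloor>) = (\<chi> i. min (u $ i) (v $ i))"
    proof -
      have "of_int \<lfloor>(u $ i + v $ i) / 2\<rfloor> = min (u $ i) (v $ i)" for i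
        using 01[of i] by auto
      then show ?thesis by simp
    qed
    moreover have "u + v - (\<chi> i. min (u $ i) (v $ i)) = (\<chi> i. max (u $ i) (v $ i))"
      by (simp add: vec_eq_iff min_def max_def)
    moreover have "(\<chi> i. min (u $ i) (v $ i)) \<in> order_polytope P r"
      "(\<chi> i. max (u $ i) (v $ i)) \<in> order_polytope P r"
    proof -
      have range: "0 \<le> min (u $ i) (v $ i) \<and> min (u $ i) (v $ i) \<le> 1"
        "0 \<le> max (u $ i) (v $ i) \<and> max (u $ i) (v $ i) \<le> 1" for i
        using 01[of i] by auto
      have mono: "min (u $ a) (v $ a) \<le> min (u $ b) (v $ b) \<and> max (u $ a) (v $ a) \<le> max (u $ b) (v $ b)"
        if "a \<in> P" "b \<in> P" "(a, b) \<in> r" for a b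
      proof -
        have "u $ a \<le> u $ b" "v $ a \<le> v $ b"
          using uv that unfolding V_def order_polytope_def by blast+
        then show ?thesis by (intro conjI min.mono max.mono)
      qed
      have "u $ a = 0 \<and> v $ a = 0" if "a \<notin> P" for a
        using uv that unfolding V_def order_polytope_def by blast
      then show "(\<chi> i. min (u $ i) (v $ i)) \<in> order_polytope P r"
        "(\<chi> i. max (u $ i) (v $ i)) \<in> order_polytope P r"
        unfolding order_polytope_def mem_Collect_eq vec_lambda_beta using range mono by auto
    qed
    moreover have "min (u $ i) (v $ i) \<in> {0, 1}" "max (u $ i) (v $ i) \<in> {0, 1}" for i
      using 01[of i] by auto
    ultimately show "(\<chi> i. of_int \<lfloor>(u $ i + v $ i) / 2\<rfloor>) \<in> V \<and>
        u + v - (\<chi> i. of_int \<lfloor>(u $ i + v $ i) / 2\<rfloor>) \<in> V"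
      by (simp add: V_def)
  next
    define D where "D = (\<lambda>a. axis a (1::real)) ` P"
    have "V \<noteq> {}" by (auto simp: V_def order_polytope_def intro!: exI[of _ 0])
    moreover have "\<exists>x\<in>V. \<exists>y\<in>V. d = x - y" if "d \<in> D" for d
    proof -
      obtain a where a: "a \<in> P" "d = axis a 1" using \<open>d \<in> D\<close> by (auto simp: D_def)
      define U where "U = {b \<in> P. (a, b) \<in> r}"
      have "trans r" "antisym r" "refl_on P r"
        using r by (auto simp: partial_order_on_def preorder_on_def)
      then have aU: "a \<in> U" and up: "\<And>b c. b \<in> U \<Longrightarrow> c \<in> P \<Longrightarrow> (b, c) \<in> r \<Longrightarrow> c \<in> U"
        and up': "\<And>b c. b \<in> U - {a} \<Longrightarrow> c \<in> P \<Longrightarrow> (b, c) \<in> r \<Longrightarrow> c \<noteq> a"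
        using a unfolding U_def by (auto dest: transD antisymD refl_onD)
      have mem: "(\<chi> i. if i \<in> W then 1 else 0) \<in> V"
        if "W \<subseteq> P" "\<And>b c. b \<in> W \<Longrightarrow> c \<in> P \<Longrightarrow> (b, c) \<in> r \<Longrightarrow> c \<in> W" for W
        using that by (auto simp: V_def order_polytope_def)
      have "(\<chi> i. if i \<in> U then 1 else 0) \<in> V"
        using up by (intro mem) (auto simp: U_def)
      moreover have "(\<chi> i. if i \<in> U - {a} then 1 else 0) \<in> V"
        using up up' by (intro mem) (auto simp: U_def)
      moreover have "d = (\<chi> i. if i \<in> U then 1 else 0) - (\<chi> i. if i \<in> U - {a} then 1 else 0)"
        using aU by (auto simp: a(2) vec_eq_iff axis_def)
      ultimately show ?thesis by blast
    qed
    ultimately have "int (dim D) \<le> aff_dim V" by (rule aff_dim_ge_dim_differences)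
    moreover have "dim D = card P"
    proof -
      have "independent D"
        by (rule independent_mono[OF independent_Basis]) (auto simp: D_def Basis_vec_def)
      then have "dim D = card D" by (rule dim_eq_card_independent)
      also have "\<dots> = card P" by (simp add: D_def card_image inj_on_def axis_eq_axis)
      finally show ?thesis .
    qed
    moreover have "card {i. \<exists>u\<in>V. \<exists>v\<in>V. u $ i \<noteq> v $ i} \<le> card P"
    proof (rule card_mono)
      show "{i. \<exists>u\<in>V. \<exists>v\<in>V. u $ i \<noteq> v $ i} \<subseteq> P"
      proof
        fix i assume "i \<in> {i. \<exists>u\<in>V. \<exists>v\<in>V. u $ i \<noteq> v $ i}"
        then obtain u v where "u \<in> V" "v \<in> V" "u $ i \<noteq> v $ i" by blast
        then show "i \<in> P" unfolding V_def order_polytope_def mem_Collect_eq by metis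
      qed
    qed simp
    ultimately show "int (card {i. \<exists>u\<in>V. \<exists>v\<in>V. u $ i \<noteq> v $ i}) \<le> aff_dim V" by linarith
  qed
  ultimately show ?thesis by simp
qed

section \<open>Alcoved polytopes\<close>

text \<open>If \<open>c\<close> exceeded \<open>l\<close> at \<open>z\<close>, the segment from \<open>q\<close> to \<open>z\<close> would cross the common hyperplane
  before reaching \<open>z\<close>, at a point where \<open>a\<close> is still below \<open>b\<close>.\<close>
lemma equal_hyperplanes_same_side:
  fixes a c q :: "real ^ 'n"
  assumes eq: "{x. a \<bullet> x = b} = {x. c \<bullet> x = l}" and q: "a \<bullet> q < b" "c \<bullet> q < l" and z: "a \<bullet> z \<le> b"
  shows "c \<bullet> z \<le> l"
proof (rule ccontr)
  assume "\<not> c \<bullet> z \<le> l"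
  then have gt: "l < c \<bullet> z" by simp
  define t where "t = (l - c \<bullet> q) / (c \<bullet> z - c \<bullet> q)"
  have t: "0 < t" "t < 1" using gt q by (auto simp: t_def field_simps)
  define p where "p = (1 - t) *\<^sub>R q + t *\<^sub>R z"
  have "c \<bullet> p = c \<bullet> q + t * (c \<bullet> z - c \<bullet> q)" by (simp add: p_def inner_add_right algebra_simps)
  also have "\<dots> = l" using gt q by (simp add: t_def)
  finally have "a \<bullet> p = b" using eq by blast
  moreover have "a \<bullet> p < (1 - t) * b + t * b"
    unfolding p_def inner_add_right inner_scaleR_right
    using t q z by (intro add_less_le_mono mult_strict_left_mono mult_left_mono) auto
  ultimately show False by (simp add: algebra_simps)
qed

text \<open>A full-dimensional polytope is the intersection of the half-spaces that its facets define, and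
  the hyperplane spanned by a facet is the given hyperplane \<open>x\<^sub>i - x\<^sub>j = l\<close>. A point \<open>q\<close> off the
  facet determines on which side of it the polytope lies.\<close>
lemma alcoved_polytope_inequalities:
  fixes Q :: "(real ^ 'n) set"
  assumes Q: "alcoved_polytope Q"
    and x: "\<And>i j l. Q \<subseteq> {z. coord0 z i - coord0 z j \<le> of_int l} \<Longrightarrow> coord0 x i - coord0 x j \<le> of_int l"
  shows "x \<in> Q"
proof -
  obtain V where V: "finite V" "Q = convex hull V"
    using Q by (auto simp: alcoved_polytope_def lattice_polytope_def)
  have dimQ: "aff_dim Q = int CARD('n)" using Q by (simp add: alcoved_polytope_def)
  then have hullQ: "affine hull Q = UNIV" using aff_dim_eq_full[of Q] by simp
  have "polyhedron Q" using V by (simp add: polyhedron_convex_hull)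
  then obtain F where F: "finite F" "Q = affine hull Q \<inter> \<Inter>F"
    "\<forall>h\<in>F. \<exists>a b. a \<noteq> 0 \<and> h = {x. a \<bullet> x \<le> b}" "\<forall>F'. F' \<subset> F \<longrightarrow> Q \<subset> affine hull Q \<inter> \<Inter>F'"
    unfolding polyhedron_Int_affine_minimal by blast
  then obtain a b where ab: "\<And>h. h \<in> F \<Longrightarrow> a h \<noteq> 0 \<and> h = {x. a h \<bullet> x \<le> b h}" by metis
  have "x \<in> h" if h: "h \<in> F" for h
  proof -
    define G where "G = Q \<inter> {x. a h \<bullet> x = b h}"
    have "G facet_of Q"
      using facet_of_polyhedron_explicit[OF F(1,2) ab, of G] F(4) h by (auto simp: G_def)
    then obtain i j l where ij: "i \<noteq> j" and G: "G \<subseteq> {x. coord0 x i - coord0 x j = of_int l}"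
      using Q unfolding alcoved_polytope_def by blast
    define c :: "real ^ 'n" where "c = unit0 i - unit0 j"
    have c: "c \<noteq> 0" using unit0_inj ij by (auto simp: c_def)
    have c_inner: "c \<bullet> x = coord0 x i - coord0 x j" for x
      by (simp add: c_def inner_diff_left unit0_inner)
    have dimG: "aff_dim (affine hull G) = int CARD('n) - 1"
      using \<open>G facet_of Q\<close> dimQ by (simp add: facet_of_def aff_dim_affine_hull)
    have neG: "affine hull G \<noteq> {}" using \<open>G facet_of Q\<close> by (simp add: facet_of_def)
    have "affine hull G = {x. a h \<bullet> x = b h}"
      using ab[OF h] dimG neG
      by (intro affine_dim_equal hull_minimal) (auto simp: G_def affine_hyperplane aff_dim_hyperplane)
    moreover have "affine hull G = {x. c \<bullet> x = of_int l}"
      using c dimG neG G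
      by (intro affine_dim_equal hull_minimal) (auto simp: c_inner[symmetric] affine_hyperplane aff_dim_hyperplane)
    ultimately have eq: "{x. a h \<bullet> x = b h} = {x. c \<bullet> x = of_int l}" by simp
    have Qh: "Q \<subseteq> {x. a h \<bullet> x \<le> b h}" using F(2) ab[OF h] h by blast
    have "\<not> Q \<subseteq> {x. a h \<bullet> x = b h}"
      using aff_dim_subset[of Q "{x. a h \<bullet> x = b h}"] ab[OF h] dimQ by (auto simp: aff_dim_hyperplane)
    then obtain q where q: "q \<in> Q" "a h \<bullet> q < b h" using Qh by force
    then have "c \<bullet> q \<noteq> of_int l" using eq by force
    have *: "a h \<bullet> x \<le> b h"
      if eq': "{x. a h \<bullet> x = b h} = {x. d \<bullet> x = of_int m}" and dq: "d \<bullet> q < of_int m"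
        and d: "\<And>x. d \<bullet> x = coord0 x i' - coord0 x j'" for d m i' j'
    proof -
      have "Q \<subseteq> {z. coord0 z i' - coord0 z j' \<le> of_int m}"
        using equal_hyperplanes_same_side[OF eq' q(2) dq] Qh by (auto simp: d[symmetric])
      then have "d \<bullet> x \<le> of_int m" using x d by simp
      then show ?thesis using equal_hyperplanes_same_side[OF eq'[symmetric] dq q(2)] by blast
    qed
    show ?thesis
    proof (cases "c \<bullet> q < of_int l")
      case True
      then show ?thesis using *[OF eq _ c_inner] ab[OF h] by blast
    next
      case False
      then have "(- c) \<bullet> q < of_int (- l)" using \<open>c \<bullet> q \<noteq> of_int l\<close> by simp
      moreover have "{x. a h \<bullet> x = b h} = {x. (- c) \<bullet> x = of_int (- l)}" using eq by simp
      moreover have "(- c) \<bullet> x = coord0 x j - coord0 x i" for x by (simp add: c_inner)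
      ultimately show ?thesis using *[of "- c" "- l"] ab[OF h] by blast
    qed
  qed
  then show ?thesis using F(2) hullQ by blast
qed

text \<open>Rounding preserves an inequality \<open>x\<^sub>i - x\<^sub>j \<le> l\<close> with integer \<open>l\<close>, so both rounded midpoints stay
  in the polytope.\<close>
theorem alcoved_polytope_triangulation:
  fixes Q :: "(real ^ 'n) set"
  assumes Q: "alcoved_polytope Q"
  shows "has_regular_unimodular_balanced_triangulation Q"
proof -
  define V where "V = Q \<inter> integer_points"
  obtain V0 where V0: "finite V0" "V0 \<subseteq> integer_points" "Q = convex hull V0"
    using Q by (auto simp: alcoved_polytope_def lattice_polytope_def)
  have "V0 \<subseteq> V" using V0 hull_subset[of V0 convex] by (auto simp: V_def)
  then have "Q \<subseteq> convex hull V" using V0(3) hull_mono by blast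
  moreover have "convex hull V \<subseteq> Q"
    using V0(3) by (intro hull_minimal) (auto simp: V_def)
  ultimately have hull: "convex hull V = Q" by blast
  have dimV: "aff_dim V = int CARD('n)"
    using Q hull by (metis aff_dim_convex_hull alcoved_polytope_def)
  have "has_regular_unimodular_balanced_triangulation (convex hull V)"
  proof (rule coordinate_alcove_triangulation)
    have "bounded Q" using V0 by (simp add: bounded_convex_hull finite_imp_bounded)
    then obtain B where B: "\<And>x. x \<in> Q \<Longrightarrow> norm x \<le> B" unfolding bounded_iff by blast
    have "x $ i \<in> {k \<in> \<int>. \<bar>k\<bar> \<le> B}" if "x \<in> V" for x i
      using that B[of x] component_le_norm_cart[of x i] by (auto simp: V_def integer_points_def)
    then show "finite V"
      by (intro finite_subset[OF _ finite_vectors_with_entries[of "{k \<in> \<int>. \<bar>k\<bar> \<le> B}"]])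
        (auto simp: finite_abs_int_segment)
    show "V \<noteq> {}" using dimV by auto
    show "V \<subseteq> integer_points" by (simp add: V_def)
  next
    fix u v assume uv: "u \<in> V" "v \<in> V"
    define u' :: "real ^ 'n" where "u' = (\<chi> i. of_int \<lfloor>(u $ i + v $ i) / 2\<rfloor>)"
    have uvint: "u \<in> integer_points" "v \<in> integer_points" "u \<in> Q" "v \<in> Q"
      using uv by (auto simp: V_def)
    have "u' \<in> integer_points" by (simp add: u'_def integer_points_def)
    then have int': "u' \<in> integer_points" "u + v - u' \<in> integer_points"
      using uvint by (auto intro: integer_points_add integer_points_diff)
    define s where "s i = \<lfloor>coord0 u i\<rfloor> + \<lfloor>coord0 v i\<rfloor>" for i
    have s: "coord0 (u + v) i = of_int (s i)" "coord0 u' i = of_int (s i div 2)" for i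
    proof -
      have "coord0 w i \<in> \<int>" if "w \<in> integer_points" for w :: "real ^ 'n"
        using that by (cases i) (auto simp: coord0_def integer_points_def)
      then have fl: "of_int \<lfloor>coord0 u i\<rfloor> = coord0 u i" "of_int \<lfloor>coord0 v i\<rfloor> = coord0 v i"
        using uvint by auto
      have "coord0 (u + v) i = coord0 u i + coord0 v i" by (cases i) (auto simp: coord0_def)
      then show "coord0 (u + v) i = of_int (s i)" by (simp add: s_def fl)
      moreover have "coord0 u' i = of_int \<lfloor>coord0 (u + v) i / 2\<rfloor>"
        by (cases i) (auto simp: coord0_def u'_def)
      moreover have "\<lfloor>real_of_int (s i) / 2\<rfloor> = s i div 2"
        by (metis floor_divide_of_int_eq of_int_numeral)
      ultimately show "coord0 u' i = of_int (s i div 2)" by simp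
    qed
    have s': "coord0 (u + v - u') i = of_int (s i - s i div 2)" for i
    proof -
      have "coord0 (u + v - u') i = coord0 (u + v) i - coord0 u' i" by (cases i) (auto simp: coord0_def)
      then show ?thesis by (simp add: s)
    qed
    have ineq: "s i \<le> s j + 2 * l" if "Q \<subseteq> {z. coord0 z i - coord0 z j \<le> of_int l}" for i j l
    proof -
      have "coord0 u i - coord0 u j \<le> of_int l" "coord0 v i - coord0 v j \<le> of_int l"
        using that uvint by auto
      moreover have "coord0 (u + v) k = coord0 u k + coord0 v k" for k
        by (cases k) (auto simp: coord0_def)
      ultimately have "real_of_int (s i) \<le> of_int (s j) + 2 * of_int l" unfolding s[symmetric] by simp
      then show ?thesis by linarith
    qed
    have "u' \<in> Q"
    proof (rule alcoved_polytope_inequalities[OF Q])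
      fix i j l assume "Q \<subseteq> {z. coord0 z i - coord0 z j \<le> of_int l}"
      then have "s i \<le> s j + 2 * l" by (rule ineq)
      then have "s i div 2 - s j div 2 \<le> l" by presburger
      then show "coord0 u' i - coord0 u' j \<le> of_int l" unfolding s by linarith
    qed
    moreover have "u + v - u' \<in> Q"
    proof (rule alcoved_polytope_inequalities[OF Q])
      fix i j l assume "Q \<subseteq> {z. coord0 z i - coord0 z j \<le> of_int l}"
      then have "s i \<le> s j + 2 * l" by (rule ineq)
      then have "(s i - s i div 2) - (s j - s j div 2) \<le> l" by presburger
      then show "coord0 (u + v - u') i - coord0 (u + v - u') j \<le> of_int l" unfolding s' by linarith
    qed
    ultimately have "u' \<in> V \<and> u + v - u' \<in> V" using int' by (simp add: V_def)
    then show "(\<chi> i. of_int \<lfloor>(u $ i + v $ i) / 2\<rfloor>) \<in> V \<and>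
        u + v - (\<chi> i. of_int \<lfloor>(u $ i + v $ i) / 2\<rfloor>) \<in> V"
      by (simp add: u'_def)
  next
    have "card {i. \<exists>u\<in>V. \<exists>v\<in>V. u $ i \<noteq> v $ i} \<le> CARD('n)" by (rule card_mono) auto
    then show "int (card {i. \<exists>u\<in>V. \<exists>v\<in>V. u $ i \<noteq> v $ i}) \<le> aff_dim V" by (simp add: dimV)
  qed
  then show ?thesis by (simp add: hull)
qed



section \<open>Hypersimplices\<close>

text \<open>In terms of the partial sums \<open>y n\<close> for an enumeration \<open>e\<close> of the indices, a hypersimplex is given by
  bounds on differences, like an alcoved polytope: consecutive partial sums differ by \<open>0\<close> or \<open>1\<close>,
  a property that rounding the midpoint down or up preserves. The partial sums \<open>y 0\<close> and \<open>y d\<close> are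
  constant, which matches the dimension \<open>d - 1\<close>. For \<open>k = 0\<close> and \<open>k = d\<close> the hypersimplex is a
  point and all partial sums are constant.\<close>
theorem hypersimplex_triangulation:
  assumes k: "k \<le> CARD('d::finite)"
  shows "has_regular_unimodular_balanced_triangulation (hypersimplex k :: (real ^ 'd) set)"
proof -
  define d where "d = CARD('d)"
  have d: "0 < d" by (simp add: d_def)
  define V where "V = {x :: real ^ 'd. (\<forall>i. x $ i = 0 \<or> x $ i = 1) \<and> card {i. x $ i = 1} = k}"
  define ind :: "'d set \<Rightarrow> real ^ 'd" where "ind A = (\<chi> i. if i \<in> A then 1 else 0)" for A
  have ind: "ind A \<in> V \<longleftrightarrow> card A = k" for A
    by (simp add: V_def ind_def)
  obtain e where e: "bij_betw e (UNIV :: 'd set) {0..<d}"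
    using ex_bij_betw_finite_nat[of "UNIV :: 'd set"] by (auto simp: d_def)
  have e_less: "e i < d" for i using bij_betwE[OF e] by simp
  have e_inj: "e i = e j \<longleftrightarrow> i = j" for i j
    using e by (auto simp: bij_betw_def dest: injD)
  have e_surj: "\<exists>i. e i = n" if "n < d" for n
    using e that unfolding bij_betw_def by (metis atLeastLessThan_iff imageE zero_le)
  define y :: "nat \<Rightarrow> real ^ 'd" where "y n = (\<chi> i. if e i < n then 1 else 0)" for n
  have y0: "y 0 = 0" by (simp add: y_def vec_eq_iff)
  have y_Suc: "y (Suc (e i)) = y (e i) + axis i 1" for i
    by (simp add: y_def vec_eq_iff axis_def less_Suc_eq e_inj)
  have step: "y (Suc (e i)) \<bullet> x - y (e i) \<bullet> x = x $ i" for i x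
    by (simp add: y_Suc inner_add_left inner_axis')
  have y_d: "y d \<bullet> x = card {i. x $ i = 1}" if "\<And>i. x $ i = 0 \<or> x $ i = 1" for x
  proof -
    have "y d \<bullet> x = (\<Sum>i\<in>UNIV. x $ i)" by (simp add: y_def inner_vec_def e_less)
    also have "\<dots> = (\<Sum>i\<in>{i. x $ i = 1}. x $ i)"
      using that by (intro sum.mono_neutral_right) auto
    finally show ?thesis by simp
  qed
  have total: "y d \<bullet> x = k" if "x \<in> V" for x
    using y_d[of x] that by (simp add: V_def)
  have V_I: "x \<in> V" if "\<And>i. x $ i = 0 \<or> x $ i = 1" "y d \<bullet> x = k" for x
    using y_d[of x] that by (simp add: V_def)
  have yint: "y n \<in> integer_points" for n by (simp add: y_def integer_points_def)
  have Vint: "V \<subseteq> integer_points"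
  proof
    fix x assume "x \<in> V"
    then have 01: "x $ i = 0 \<or> x $ i = 1" for i by (auto simp: V_def)
    have "x $ i \<in> \<int>" for i using 01[of i] by auto
    then show "x \<in> integer_points" by (simp add: integer_points_def)
  qed
  have neV: "V \<noteq> {}"
  proof -
    obtain A :: "'d set" where "card A = k" using obtain_subset_with_card_n[OF k] by blast
    then show ?thesis using ind by blast
  qed
  have "has_regular_unimodular_balanced_triangulation (convex hull V)"
  proof (rule alcove_triangulation[of "{..d}" V y 0])
    show "finite V"
      by (rule finite_subset[OF _ finite_vectors_with_entries[of "{0, 1}"]]) (auto simp: V_def)
    fix u v assume uv: "u \<in> V" "v \<in> V"
    show "u = v" if eq: "\<And>i. i \<in> {..d} \<Longrightarrow> y i \<bullet> u = y i \<bullet> v"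
      unfolding vec_eq_iff
    proof
      fix i
      show "u $ i = v $ i"
        using step[of i u] step[of i v] eq[of "e i"] eq[of "Suc (e i)"] e_less[of i] by simp
    qed
    define s where "s n = \<lfloor>y n \<bullet> (u + v)\<rfloor>" for n
    have s: "y n \<bullet> (u + v) = of_int (s n)" for n
    proof -
      have "y n \<bullet> (u + v) \<in> \<int>"
        using inner_integer_points[OF yint] integer_points_add Vint uv by blast
      then show ?thesis unfolding s_def by (metis Ints_cases floor_of_int)
    qed
    \<comment> \<open>The point whose partial sums are the halves of \<open>s\<close>, rounded down.\<close>
    define u' :: "real ^ 'd" where "u' = (\<chi> i. of_int (s (Suc (e i)) div 2 - s (e i) div 2))"
    have u': "y n \<bullet> u' = of_int (s n div 2)" if "n \<le> d" for n
      using that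
    proof (induction n)
      case 0
      have "real_of_int (s 0) = 0" using s[of 0] by (simp add: y0)
      then show ?case by (simp add: y0)
    next
      case (Suc n)
      then obtain i where i: "e i = n" using e_surj[of n] by auto
      have "y (Suc n) \<bullet> u' = y n \<bullet> u' + u' $ i" using step[of i u'] i by simp
      then show ?case using Suc by (simp add: u'_def i)
    qed
    have floor: "\<lfloor>y n \<bullet> (u + v) / 2\<rfloor> = s n div 2" for n
      unfolding s by (metis floor_divide_of_int_eq of_int_numeral)
    have sd: "s d = 2 * int k"
    proof -
      have "real_of_int (s d) = of_int (2 * int k)"
        using total[OF uv(1)] total[OF uv(2)] by (simp add: s[symmetric] inner_add_right)
      then show ?thesis by linarith
    qed
    have entries: "(u' $ i = 0 \<or> u' $ i = 1) \<and> ((u + v - u') $ i = 0 \<or> (u + v - u') $ i = 1)" for i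
    proof -
      define c where "c = s (Suc (e i)) - s (e i)"
      have uvc: "(u + v) $ i = of_int c" using step[of i "u + v"] by (simp add: s c_def)
      have "u $ i = 0 \<or> u $ i = 1" "v $ i = 0 \<or> v $ i = 1" using uv by (auto simp: V_def)
      then have "of_int c = (0::real) \<or> of_int c = (1::real) \<or> of_int c = (2::real)"
        unfolding uvc[symmetric] by auto
      then have c: "c = 0 \<or> c = 1 \<or> c = 2" by linarith
      define w where "w = s (Suc (e i)) div 2 - s (e i) div 2"
      have "(w = 0 \<or> w = 1) \<and> (c - w = 0 \<or> c - w = 1)"
        using c unfolding c_def w_def by presburger
      moreover have "u' $ i = of_int w" by (simp add: u'_def w_def)
      moreover have "(u + v - u') $ i = of_int (c - w)" using uvc \<open>u' $ i = of_int w\<close> by simp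
      ultimately show ?thesis by auto
    qed
    have "u' \<in> V" using entries u'[of d] sd by (intro V_I) auto
    moreover have "u + v - u' \<in> V"
      using entries u'[of d] s[of d] sd by (intro V_I) (auto simp: inner_diff_right)
    ultimately show "\<exists>u'\<in>V. u + v - u' \<in> V \<and> (\<forall>i\<in>{..d}. y i \<bullet> u' = of_int \<lfloor>y i \<bullet> (u + v) / 2\<rfloor>)"
      using u' by (intro bexI[of _ u']) (auto simp: floor)
  next
    define N where "N = {n \<in> {..d}. \<exists>u\<in>V. \<exists>v\<in>V. y n \<bullet> u \<noteq> y n \<bullet> v}"
    have "int (card N) \<le> aff_dim V"
    proof (cases "0 < k \<and> k < d")
      case kd: True
      define j :: 'd where "j = undefined"
      define D where "D = range (\<lambda>i. axis i 1 - axis j (1::real))"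
      have diff: "\<exists>x\<in>V. \<exists>y\<in>V. z = x - y" if "z \<in> D" for z
      proof -
        obtain i where z: "z = axis i 1 - axis j 1" using \<open>z \<in> D\<close> by (auto simp: D_def)
        show ?thesis
        proof (cases "i = j")
          case True
          then show ?thesis using neV z by auto
        next
          case False
          have "card (UNIV - {i, j}) = d - 2" using False by (simp add: card_Diff_subset d_def)
          then have "k - 1 \<le> card (UNIV - {i, j})" using kd by linarith
          then obtain A where A: "A \<subseteq> UNIV - {i, j}" "card A = k - 1"
            by (rule obtain_subset_with_card_n)
          then have "finite A" "i \<notin> A" "j \<notin> A" by auto
          have "ind (insert i A) \<in> V" "ind (insert j A) \<in> V"
            unfolding ind using A(2) kd \<open>finite A\<close> \<open>i \<notin> A\<close> \<open>j \<notin> A\<close> by simp_all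
          moreover have "z = ind (insert i A) - ind (insert j A)"
            using \<open>i \<notin> A\<close> \<open>j \<notin> A\<close> False by (auto simp: z ind_def vec_eq_iff axis_def)
          ultimately show ?thesis by blast
        qed
      qed
      have "axis i 1 \<in> span (insert (axis j 1) D)" for i
      proof -
        have "(axis i 1 - axis j 1) + axis j 1 \<in> span (insert (axis j 1) D)"
          by (intro span_add span_base) (auto simp: D_def)
        then show ?thesis by simp
      qed
      then have "(Basis :: (real ^ 'd) set) \<subseteq> span (insert (axis j 1) D)"
        by (auto simp: Basis_vec_def)
      then have "dim (Basis :: (real ^ 'd) set) \<le> dim (insert (axis j 1) D)" by (rule dim_mono)
      then have "d \<le> dim D + 1" by (auto simp: d_def dim_insert dim_Basis_cart split: if_splits)
      moreover have dimD: "int (dim D) \<le> aff_dim V"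
        by (rule aff_dim_ge_dim_differences[OF neV]) (rule diff)
      moreover have "N \<subseteq> {1..<d}"
      proof
        fix n assume "n \<in> N"
        then obtain u v where "n \<le> d" "u \<in> V" "v \<in> V" "y n \<bullet> u \<noteq> y n \<bullet> v" by (auto simp: N_def)
        moreover from this have "n \<noteq> 0" using y0 by (metis inner_zero_left)
        moreover from calculation have "n \<noteq> d" using total by metis
        ultimately show "n \<in> {1..<d}" by simp
      qed
      then have "card N \<le> d - 1" using card_mono[of "{1..<d}" N] by simp
      ultimately show ?thesis using dimD d by linarith
    next
      case False
      then have "k = 0 \<or> k = d" using k d_def by linarith
      then have "x = y" if "x \<in> V" "y \<in> V" for x y
      proof
        assume "k = 0"
        then show ?thesis using that by (auto simp: V_def vec_eq_iff)
      next
        assume kd: "k = d"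
        have "{i. x $ i = 1} = UNIV" if "x \<in> V" for x
          using that kd by (intro card_subset_eq) (auto simp: V_def d_def)
        then have "x $ i = 1" if "x \<in> V" for x i using that by blast
        then show ?thesis using that by (simp add: vec_eq_iff)
      qed
      then have "N = {}" unfolding N_def by blast
      moreover have "0 \<le> aff_dim V" using neV aff_dim_negative_iff[of V] by linarith
      ultimately show ?thesis by simp
    qed
    then show "int (card {n \<in> {..d}. \<exists>u\<in>V. \<exists>v\<in>V. y n \<bullet> u \<noteq> y n \<bullet> v}) \<le> aff_dim V"
      by (simp add: N_def)
  qed (use neV Vint yint y0 in auto)
  then show ?thesis by (simp add: V_def hypersimplex_def)
qed

section \<open>Cross polytopes\<close>

lemma cross_polytope_convex_hull:
  "convex hull (insert 0 (range (\<lambda>i. axis i 1) \<union> range (\<lambda>i. axis i (-1)))) =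
    (cross_polytope :: (real ^ 'd) set)"
  (is "convex hull ?V = _")
proof
  have "convex (cross_polytope :: (real ^ 'd) set)"
  proof (rule convexI)
    fix x y :: "real ^ 'd" and s t :: real
    assume x: "x \<in> cross_polytope" and y: "y \<in> cross_polytope" and st: "0 \<le> s" "0 \<le> t" "s + t = 1"
    have "(\<Sum>i\<in>UNIV. \<bar>(s *\<^sub>R x + t *\<^sub>R y) $ i\<bar>) \<le> (\<Sum>i\<in>UNIV. s * \<bar>x $ i\<bar> + t * \<bar>y $ i\<bar>)"
    proof (rule sum_mono)
      fix i
      show "\<bar>(s *\<^sub>R x + t *\<^sub>R y) $ i\<bar> \<le> s * \<bar>x $ i\<bar> + t * \<bar>y $ i\<bar>"
        using abs_triangle_ineq[of "s * x $ i" "t * y $ i"] st by (simp add: abs_mult)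
    qed
    also have "\<dots> = s * (\<Sum>i\<in>UNIV. \<bar>x $ i\<bar>) + t * (\<Sum>i\<in>UNIV. \<bar>y $ i\<bar>)"
      by (simp add: sum.distrib sum_distrib_left)
    also have "\<dots> \<le> s * 1 + t * 1"
      using x y st by (intro add_mono mult_left_mono) (auto simp: cross_polytope_def)
    finally show "s *\<^sub>R x + t *\<^sub>R y \<in> cross_polytope" using st by (simp add: cross_polytope_def)
  qed
  moreover have "?V \<subseteq> cross_polytope"
    by (auto simp: cross_polytope_def axis_def if_distrib[of abs] cong: if_cong)
  ultimately show "convex hull ?V \<subseteq> cross_polytope" by (intro hull_minimal)
next
  show "cross_polytope \<subseteq> convex hull ?V"
  proof
    fix x :: "real ^ 'd" assume x: "x \<in> cross_polytope"
    define l where "l i = (case i of None \<Rightarrow> 1 - (\<Sum>i\<in>UNIV. \<bar>x $ i\<bar>) | Some j \<Rightarrow> \<bar>x $ j\<bar>)" for i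
    define w :: "'d option \<Rightarrow> real ^ 'd"
      where "w i = (case i of None \<Rightarrow> 0 | Some j \<Rightarrow> axis j (if x $ j < 0 then -1 else 1))" for i
    have opt: "(\<Sum>i\<in>UNIV. f i) = f None + (\<Sum>j\<in>UNIV. f (Some j))" for f :: "'d option \<Rightarrow> 'b::comm_monoid_add"
      by (simp add: UNIV_option_conv sum.reindex)
    have "(\<Sum>i\<in>UNIV. l i *\<^sub>R w i) \<in> convex hull ?V"
    proof (rule convex_sum)
      show "sum l UNIV = 1" by (simp add: opt l_def)
      fix i
      show "0 \<le> l i" using x by (auto simp: l_def cross_polytope_def split: option.split)
      show "w i \<in> convex hull ?V" by (rule hull_inc) (auto simp: w_def split: option.split)
    qed auto
    also have "(\<Sum>i\<in>UNIV. l i *\<^sub>R w i) = (\<Sum>j\<in>UNIV. axis j (x $ j))"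
    proof -
      have "l (Some j) *\<^sub>R w (Some j) = axis j (x $ j)" for j
        by (auto simp: l_def w_def vec_eq_iff axis_def)
      moreover have "w None = 0" by (simp add: w_def)
      ultimately show ?thesis by (simp add: opt)
    qed
    also have "\<dots> = x"
      by (simp add: vec_eq_iff axis_def)
    finally show "x \<in> convex hull ?V" .
  qed
qed

text \<open>Two vertices fail to be close only if they are opposite, and these are resolved to \<open>0 + 0\<close>. The
  form \<open>axis i 1\<close> singles out the vertex on the \<open>i\<close>-th axis. The origin and each axis get their own
  colour, the origin colour \<open>0\<close>.\<close>
theorem cross_polytope_triangulation:
  "has_regular_unimodular_balanced_triangulation (cross_polytope :: (real ^ 'd) set)"
proof -
  define V :: "(real ^ 'd) set" where
    "V = insert 0 (range (\<lambda>i. axis i 1) \<union> range (\<lambda>i. axis i (-1)))"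
  define \<Phi> :: "(real ^ 'd) set" where "\<Phi> = range (\<lambda>i. axis i 1)"
  have V_cases: "v = 0 \<or> (\<exists>i. v = axis i 1 \<or> v = axis i (-1))" if "v \<in> V" for v
    using that by (auto simp: V_def)
  have zero: "0 \<in> V" by (simp add: V_def)
  interpret close_points \<Phi> V
    by unfold_locales (auto simp: V_def \<Phi>_def integer_points_def axis_def)
  have close_iff: "close u v \<longleftrightarrow> (\<forall>i. \<bar>u $ i - v $ i\<bar> \<le> 1)" for u v
    unfolding close_def by (simp add: \<Phi>_def inner_axis')
  have not_close: "\<not> close (axis i 1) (axis i (-1))" for i
    unfolding close_iff by (auto simp: axis_def intro!: exI[of _ i])
  have opposite: "\<exists>i. {u, v} = {axis i 1, axis i (-1)}"
    if uv: "u \<in> V" "v \<in> V" "u \<noteq> v" and common: "\<exists>i. u $ i \<noteq> 0 \<and> v $ i \<noteq> 0" for u v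
  proof -
    obtain i where i: "u $ i \<noteq> 0" "v $ i \<noteq> 0" using common by blast
    have "w = axis i 1 \<or> w = axis i (-1)" if "w \<in> V" "w $ i \<noteq> 0" for w
      using V_cases[OF that(1)] that(2) by (auto simp: axis_def split: if_splits)
    then show ?thesis using i uv by blast
  qed
  interpret close_points_triangulation \<Phi> V
  proof
    fix u v assume uv: "u \<in> V" "v \<in> V" "\<not> close u v"
    then obtain i where i: "\<bar>u $ i - v $ i\<bar> > 1" by (auto simp: close_iff not_le)
    have abs1: "\<bar>w $ i\<bar> \<le> 1" if "w \<in> V" for w
      using V_cases[OF that] by (auto simp: axis_def)
    have "u $ i \<noteq> 0 \<and> v $ i \<noteq> 0" using i abs1[OF uv(1)] abs1[OF uv(2)] by auto
    moreover have "u \<noteq> v" using i by auto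
    ultimately obtain j where "{u, v} = {axis j 1, axis j (-1)}" using opposite uv by blast
    then have "u + v = 0" by (auto simp: doubleton_eq_iff vec_eq_iff axis_def)
    then show "\<exists>u'\<in>V. \<exists>v'\<in>V. u' + v' = u + v \<and> close u' v'"
      using zero close_refl by (intro bexI[of _ 0]) auto
  next
    fix \<sigma> u w assume \<sigma>: "clique \<sigma>" "u \<in> \<sigma>" "w \<in> \<sigma>" "u \<noteq> w"
    have V': "\<sigma> \<subseteq> V" and cl: "\<And>u v. u \<in> \<sigma> \<Longrightarrow> v \<in> \<sigma> \<Longrightarrow> close u v"
      using \<sigma>(1) by (auto simp: clique_def)
    obtain v where v: "v \<in> \<sigma>" "v \<noteq> 0" using \<sigma> by metis
    then obtain i where i: "v = axis i 1 \<or> v = axis i (-1)" using V_cases V' by blast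
    then have vi: "\<bar>v $ i\<bar> = 1" by auto
    have "z $ i = 0" if z: "z \<in> \<sigma> - {v}" for z
    proof (rule ccontr)
      assume "z $ i \<noteq> 0"
      then have "\<exists>i. {v, z} = {axis i 1, axis i (-1)}"
        using opposite[of v z] v z V' vi by force
      then show False using cl[of v z] cl[of z v] v z not_close by (auto simp: doubleton_eq_iff)
    qed
    then show "\<exists>v\<in>\<sigma>. \<exists>\<phi>\<in>\<Phi>. \<exists>n. \<bar>\<phi> \<bullet> v - n\<bar> = 1 \<and> (\<forall>w\<in>\<sigma> - {v}. \<phi> \<bullet> w = n)"
      using v(1) vi by (intro bexI[of _ v] bexI[of _ "axis i 1"] exI[of _ 0])
        (auto simp: inner_axis' \<Phi>_def)
  qed
  obtain e where e: "bij_betw e (UNIV :: 'd set) {0..<CARD('d)}"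
    using ex_bij_betw_finite_nat[of "UNIV :: 'd set"] by auto
  have e_less: "e i < CARD('d)" for i using bij_betwE[OF e] by simp
  have e_inj: "e i = e j \<longleftrightarrow> i = j" for i j
    using e by (auto simp: bij_betw_def dest: injD)
  define col where "col v = (if v = 0 then 0 else Suc (e (SOME i. v $ i \<noteq> 0)))" for v :: "real ^ 'd"
  have some: "v $ (SOME i. v $ i \<noteq> 0) \<noteq> 0" if "v \<noteq> 0" for v :: "real ^ 'd"
  proof -
    have "\<exists>i. v $ i \<noteq> 0" using that by (simp add: vec_eq_iff)
    then show ?thesis by (rule someI_ex)
  qed
  have "int (dim (Basis :: (real ^ 'd) set)) \<le> aff_dim V"
  proof (rule aff_dim_ge_dim_differences)
    show "V \<noteq> {}" using zero by blast
    fix b :: "real ^ 'd" assume "b \<in> Basis"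
    then have "b \<in> V" by (auto simp: Basis_vec_def V_def)
    then show "\<exists>x\<in>V. \<exists>y\<in>V. b = x - y" using zero by (intro bexI[of _ b] bexI[of _ 0]) auto
  qed
  then have dim: "int CARD('d) \<le> aff_dim V" by (simp add: dim_Basis_cart)
  have "has_regular_unimodular_balanced_triangulation (convex hull V)"
  proof (rule has_triangulation[of col])
    fix v :: "real ^ 'd"
    show "int (col v) \<le> aff_dim V"
      using dim e_less[of "SOME i. v $ i \<noteq> 0"] by (auto simp: col_def)
  next
    fix u v assume uv: "u \<in> V" "v \<in> V" "u \<noteq> v" "close u v"
    show "col u \<noteq> col v"
    proof
      assume eq: "col u = col v"
      then have "u \<noteq> 0" "v \<noteq> 0" using uv(3) by (auto simp: col_def split: if_splits)
      moreover from this have "(SOME i. u $ i \<noteq> 0) = (SOME i. v $ i \<noteq> 0)"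
        using eq by (simp add: col_def e_inj)
      ultimately have "\<exists>i. u $ i \<noteq> 0 \<and> v $ i \<noteq> 0" using some[of u] some[of v] by metis
      then obtain i where "{u, v} = {axis i 1, axis i (-1)}" using opposite uv by blast
      then show False using uv(4) not_close[of i] close_sym by (auto simp: doubleton_eq_iff)
    qed
  qed
  then show ?thesis by (simp add: V_def cross_polytope_convex_hull)
qed

section \<open>The four families\<close>

theorem mainTheorem7:
  shows
    "(\<forall>(P :: 'p::finite set) r. partial_order_on P r \<longrightarrow>
        has_regular_unimodular_balanced_triangulation (order_polytope P r)) \<and>
     (\<forall>k. k \<le> CARD('d::finite) \<longrightarrow>
        has_regular_unimodular_balanced_triangulation (hypersimplex k :: (real ^ 'd) set)) \<and>
     has_regular_unimodular_balanced_triangulation (cross_polytope :: (real ^ 'd) set) \<and>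
     (\<forall>Q :: (real ^ 'd) set. alcoved_polytope Q \<longrightarrow>
        has_regular_unimodular_balanced_triangulation Q)"
  by (intro conjI allI impI order_polytope_triangulation hypersimplex_triangulation
      cross_polytope_triangulation alcoved_polytope_triangulation)

end
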